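(* Let $f:\mathbb{R}^d\to\mathbb{R}$ be $\mathcal C^1$, bounded from below, subanalytic, with globally $L_f$-Lipschitz gradient. Let $(\sigma_k)_{k\ge 0}$ be a (deterministic) sequence of reals with $\sigma_{k+1}\le\sigma_k$ for all $k$ and $\sigma_k\to\epsilon>0$, and set $I_\epsilon=[\epsilon,\sigma_0]$. Let $(g_\sigma)_{\sigma>0}$ be a family of functions $g_\sigma:\mathbb{R}^d\to\mathbb{R}$ such that $(x,\sigma)\mapsto g_\sigma(x)$ is jointly $\mathcal C^2$ and subanalytic on $\mathbb{R}^d\times(0,\infty)$, $\nabla g_\sigma$ is $L_g$-Lipschitz for all $\sigma\in I_\epsilon$, and there are positive constants $c_0,C_0,M_g$ such that for all $x\in\mathbb{R}^d$ and $\sigma\in I_\epsilon$, $$g_\sigma(x)\ge c_0\|x\|^2-C_0,\qquad |\partial_\sigma g_\sigma(x)|\le M_g(1+\|x\|^2).$$ Put $D_\sigma=\mathrm{Id}-\nabla g_\sigma$ and let $\lambda>0$. Let $\pi$ be a probability distribution supported on a subgroup of the orthogonal group of $\mathbb{R}^d$, and let $(Q_k)_{k\ge1}$ be i.i.d. with law $\pi$. Let $(\gamma_k)_{k\ge0}$ be (deterministic) stepsizes and $\bar\gamma$ a constant such that $$0<\gamma_k\le\bar\gamma,\qquad (L_f+\lambda L_g)\bar\gamma<2,\qquad \sum_k\gamma_k=\infty,\qquad \sum_k\gamma_k^2<\infty .$$ For a deterministic starting point $x_0\in\mathbb{R}^d$, define $$x_{k+1}=x_k-\gamma_k\bigl[\nabla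 f(x_k)+\lambda\bigl(x_k-Q_{k+1}^\top D_{\sigma_k}(Q_{k+1}x_k)\bigr)\bigr],\qquad k\ge0 .$$ Let $\bar g_\sigma(x)=\mathbb{E}_{Q\sim\pi}[g_\sigma(Qx)]$ and $F_\sigma=f+\lambda\bar g_\sigma$. Then the iterates are almost surely bounded, $F_\epsilon(x_k)$ converges almost surely, and almost surely $$\sum_k\gamma_k\|\nabla F_{\sigma_k}(x_k)\|^2<\infty,\qquad \|\nabla F_\epsilon(x_k)\|\to0,\qquad \operatorname{dist}(x_k,\operatorname{crit}F_\epsilon)\to0 .$$ Moreover, $\|x_{k+1}-x_k\|\to0$ almost surely and $$\min_{0\le k\le K}\mathbb{E}\|\nabla F_{\sigma_k}(x_k)\|^2=\mathcal O\Bigl(\bigl(\textstyle\sum_{k=0}^{K}\gamma_k\bigr)^{-1}\Bigr)\quad\text{as }K\to\infty .$$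
   Context: $\nabla$ denotes the gradient with respect to $x$. $\operatorname{crit}F_\epsilon=\{x\in\mathbb{R}^d:\nabla F_\epsilon(x)=0\}$ and $\operatorname{dist}$ is Euclidean distance to a set. No convexity of $f$ or $g_\sigma$ is assumed. *)

theory Defs
  imports "HOL-Probability.Probability" "HOL-Library.Landau_Symbols" "HOL-Algebra.Group"
begin

section \<open>Differential calculus\<close>

text \<open>For open \<open>S\<close>; \<open>f'\<close> is the Frechet derivative, continuous in operator norm.\<close>

definition C1_on :: "'a::real_normed_vector set \<Rightarrow> ('a \<Rightarrow> 'b::real_normed_vector) \<Rightarrow> bool" where
  "C1_on S f \<longleftrightarrow>
     (\<exists>f' :: 'a \<Rightarrow> 'a \<Rightarrow>\<^sub>L 'b.
        (\<forall>x\<in>S. (f has_derivative blinfun_apply (f' x)) (at x)) \<and> continuous_on S f')"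

definition C2_on :: "'a::real_normed_vector set \<Rightarrow> ('a \<Rightarrow> 'b::real_normed_vector) \<Rightarrow> bool" where
  "C2_on S f \<longleftrightarrow>
     (\<exists>f' :: 'a \<Rightarrow> 'a \<Rightarrow>\<^sub>L 'b.
        (\<forall>x\<in>S. (f has_derivative blinfun_apply (f' x)) (at x)) \<and> C1_on S f')"

text \<open>Meaningful wherever \<open>f\<close> is differentiable; arbitrary elsewhere.\<close>

definition gradient :: "('a::real_inner \<Rightarrow> real) \<Rightarrow> 'a \<Rightarrow> 'a" where
  "gradient f x = (SOME D. GDERIV f x :> D)"

definition crit :: "('a::real_inner \<Rightarrow> real) \<Rightarrow> 'a set" where
  "crit f = {x. gradient f x = 0}"


section \<open>Subanalytic sets and functions\<close>

text \<open>
  The definition of a subanalytic set quantifies over an auxiliary space of arbitrary finite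
  dimension. Therefore real-analytic functions and semianalytic sets are formulated in coordinates,
  on the space \<open>I \<rightarrow>\<^sub>E UNIV\<close> of real families indexed by a finite set \<open>I\<close>.
\<close>

definition coord_box :: "'i set \<Rightarrow> ('i \<Rightarrow> real) \<Rightarrow> real \<Rightarrow> ('i \<Rightarrow> real) set" where
  "coord_box I p r = {y \<in> I \<rightarrow>\<^sub>E UNIV. \<forall>i\<in>I. \<bar>y i - p i\<bar> < r}"

text \<open>Around each point of the open set \<open>V\<close>, \<open>h\<close> is the sum of an (unconditionally, equivalently
  absolutely) convergent power series; \<open>\<alpha>\<close> ranges over multi-indices.\<close>

definition real_analytic_coords :: "'i set \<Rightarrow> ('i \<Rightarrow> real) set \<Rightarrow> (('i \<Rightarrow> real) \<Rightarrow> real) \<Rightarrow> bool" where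
  "real_analytic_coords I V h \<longleftrightarrow>
     (\<forall>p\<in>V. \<exists>r>0. \<exists>c :: ('i \<Rightarrow> nat) \<Rightarrow> real. \<forall>y\<in>coord_box I p r.
        ((\<lambda>\<alpha>. c \<alpha> * (\<Prod>i\<in>I. (y i - p i) ^ \<alpha> i)) has_sum h y) (I \<rightarrow>\<^sub>E UNIV))"

text \<open>Each point has a neighbourhood in which \<open>A\<close> is a finite union of finite intersections of sets
  given by analytic equations and strict analytic inequalities. Boxes form a neighbourhood base,
  so it does no harm to use them as neighbourhoods.\<close>

definition semianalytic_coords :: "'i set \<Rightarrow> ('i \<Rightarrow> real) set \<Rightarrow> bool" where
  "semianalytic_coords I A \<longleftrightarrow>
     A \<subseteq> I \<rightarrow>\<^sub>E UNIV \<and>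
     (\<forall>x \<in> I \<rightarrow>\<^sub>E UNIV. \<exists>r>0. \<exists>(p::nat) (q::nat) F G.
        (\<forall>i<p. \<forall>j<q. real_analytic_coords I (coord_box I x r) (F i j) \<and>
                      real_analytic_coords I (coord_box I x r) (G i j)) \<and>
        A \<inter> coord_box I x r =
          (\<Union>i<p. {y \<in> coord_box I x r. \<forall>j<q. F i j y = 0 \<and> G i j y > 0}))"

text \<open>\<open>W\<close> is an open subset of a Euclidean space, and \<open>A\<close> is subanalytic as a subset of the manifold
  \<open>W\<close>: each point of \<open>W\<close> has a neighbourhood in which \<open>A\<close> is the projection of a bounded semianalytic
  set \<open>B\<close> of the product with some \<open>\<real>\<^sup>m\<close>. The index \<open>Inl b\<close> stands for the coordinate along the
  basis vector \<open>b\<close>, and \<open>Inr j\<close> for the \<open>j\<close>-th auxiliary coordinate.\<close>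

definition subanalytic_in :: "'a::euclidean_space set \<Rightarrow> 'a set \<Rightarrow> bool" where
  "subanalytic_in W A \<longleftrightarrow>
     A \<subseteq> W \<and>
     (\<forall>x\<in>W. \<exists>V. open V \<and> x \<in> V \<and> V \<subseteq> W \<and>
        (\<exists>m\<ge>1. \<exists>B :: ('a + nat \<Rightarrow> real) set.
           semianalytic_coords (Basis <+> {..<m}) B \<and>
           (\<exists>R. \<forall>z\<in>B. \<forall>i \<in> Basis <+> {..<m}. \<bar>z i\<bar> \<le> R) \<and>
           A \<inter> V = (\<lambda>z. \<Sum>b\<in>Basis. z (Inl b) *\<^sub>R b) ` B))"

definition subanalytic_on :: "'a::euclidean_space set \<Rightarrow> ('a \<Rightarrow> real) \<Rightarrow> bool" where
  "subanalytic_on U f \<longleftrightarrow> subanalytic_in (U \<times> UNIV) ((\<lambda>x. (x, f x)) ` U)"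


section \<open>The denoiser and the averaged objective\<close>

definition orthogonal_group :: "(real^'n^'n) monoid" where
  "orthogonal_group = \<lparr>carrier = {Q. orthogonal_matrix Q}, mult = (\<lambda>A B. A ** B), one = mat 1\<rparr>"

definition denoiser :: "(real \<Rightarrow> real^'n \<Rightarrow> real) \<Rightarrow> real \<Rightarrow> real^'n \<Rightarrow> real^'n" where
  "denoiser g \<sigma> x = x - gradient (g \<sigma>) x"

definition avg_pot :: "(real^'n^'n) measure \<Rightarrow> (real \<Rightarrow> real^'n \<Rightarrow> real) \<Rightarrow> real \<Rightarrow> real^'n \<Rightarrow> real" where
  "avg_pot \<pi> g \<sigma> x = (LINT Q|\<pi>. g \<sigma> (Q *v x))"

definition objective ::
  "(real^'n \<Rightarrow> real) \<Rightarrow> real \<Rightarrow> (real^'n^'n) measure \<Rightarrow> (real \<Rightarrow> real^'n \<Rightarrow> real) \<Rightarrow>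
   real \<Rightarrow> real^'n \<Rightarrow> real" where
  "objective f lam \<pi> g \<sigma> x = f x + lam * avg_pot \<pi> g \<sigma> x"

end

theory Submission
  imports Defs
begin

text \<open>
  Let \<open>V\<^sub>k\<close> be \<open>F\<close> at \<open>\<sigma>\<^sub>k\<close> plus a constant making it at least \<open>1\<close>. By coercivity \<open>1 + \<parallel>y\<parallel>\<^sup>2\<close> is bounded by a
  multiple of \<open>V\<^sub>k(y)\<close>, hence so are the squared stochastic gradient and the error made by passing from
  \<open>\<sigma>\<^sub>k\<close> to the next parameter. The descent lemma then gives
  \<open>ln V\<^sub>k\<^sub>+\<^sub>1(x\<^sub>k\<^sub>+\<^sub>1) \<le> ln V\<^sub>k(x\<^sub>k) - \<gamma>\<^sub>k \<parallel>\<nabla>F\<parallel>\<^sup>2 / V\<^sub>k(x\<^sub>k) + (summable) + (martingale increment)\<close>, where the increment is at most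
  a constant times \<open>\<gamma>\<^sub>k\<close>. Kolmogorov's maximal inequality sums the increments almost surely, so the logarithms
  converge and the descent terms are summable; this replaces the Robbins-Siegmund theorem. Taking
  expectations before logarithms removes the noise and gives the rate. Along a bounded trajectory the
  gradient changes by at most a constant times \<open>\<gamma>\<^sub>k\<close> per step, which together with the summability forces it
  to \<open>0\<close>.
\<close>

section \<open>Real sequences\<close>

text \<open>Subtracting the partial sums of \<open>s + n\<close> from \<open>u\<close> leaves a
  decreasing sequence that is bounded below, and its total decrease bounds the sum of
  \<open>b\<close>. The perturbations may have either sign and need not converge absolutely, which
  is what allows \<open>n\<close> to be random noise.\<close>

lemma perturbed_decreasing_convergent:
  fixes u s b n :: "nat \<Rightarrow> real"
  assumes step: "\<And>k. u (Suc k) \<le> u k + s k - b k + n k"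
    and u: "\<And>k. c \<le> u k" and b: "\<And>k. 0 \<le> b k"
    and s: "summable s" and n: "summable n"
  shows "convergent u" "summable b"
proof -
  define S where "S k = (\<Sum>i<k. s i + n i)" for k
  have sn: "summable (\<lambda>k. s k + n k)"
    using s n by (rule summable_add)
  then have S_conv: "convergent S"
    unfolding S_def by (simp add: summable_iff_convergent)
  then obtain K where K: "\<And>k. \<bar>S k\<bar> \<le> K"
    using convergent_imp_Bseq[OF S_conv] by (auto simp: Bseq_def)
  define w where "w k = u k - S k" for k
  have w_step: "w (Suc k) \<le> w k - b k" for k
    using step[of k] by (simp add: w_def S_def)
  have w_low: "c - K \<le> w k" for k
    using u[of k] K[of k] by (simp add: w_def)
  have "decseq w"
    using w_step b by (intro decseq_SucI) (smt (verit))
  then have "convergent w"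
    using w_low by (metis decseq_convergent convergentI)
  then have "convergent (\<lambda>k. w k + S k)"
    using S_conv by (rule convergent_add)
  then show "convergent u"
    by (simp add: w_def)
  have "(\<Sum>i<k. b i) \<le> w 0 - w k" for k
    using w_step by (induction k) (auto, smt (verit))
  then have "(\<Sum>i<k. b i) \<le> w 0 - (c - K)" for k
    using w_low[of k] by (smt (verit))
  then show "summable b"
    using b by (intro summableI_nonneg_bounded[of b "w 0 - (c - K)"])
qed

text \<open>Both factors are estimated by \<open>ln (1 + t) \<le> t\<close>. The logarithm turns the
  multiplicative recursion for the potential into an additive one, with the perturbation measured
  relative to \<open>v\<close>.\<close>

lemma multiplicative_recursion_ln:
  fixes v v' a p :: real
  assumes "0 < v" "0 < v'" "0 \<le> a" and le: "v' \<le> (1 + a) * (v + p)"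
  shows "ln v' \<le> ln v + a + p / v"
proof -
  \<comment> \<open>Otherwise the right side of \<open>le\<close> would be at most 0, against
    \<open>0 < v'\<close>.\<close>
  have "0 < v + p"
    using assms by (smt (verit) mult_nonneg_nonpos)
  then have "0 < 1 + p / v"
    using \<open>0 < v\<close> by (simp add: field_simps)
  have "ln v' \<le> ln ((1 + a) * (v + p))"
    using assms \<open>0 < v + p\<close> by simp
  also have "(1 + a) * (v + p) = (1 + a) * (v * (1 + p / v))"
    using \<open>0 < v\<close> by (simp add: field_simps)
  also have "ln \<dots> = ln (1 + a) + (ln v + ln (1 + p / v))"
    using assms \<open>0 < 1 + p / v\<close> by (simp add: ln_mult_pos)
  also have "\<dots> \<le> a + (ln v + p / v)"
    using ln_add_one_self_le_self[OF \<open>0 \<le> a\<close>] ln_le_minus_one[OF \<open>0 < 1 + p / v\<close>] by simp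
  finally show ?thesis by simp
qed

text \<open>Since \<open>\<gamma>\<close> is not summable, \<open>r\<close> cannot stay away from 0,
  so \<open>h\<close> is small at arbitrarily late times. After such a time \<open>h\<close> can
  climb further only while \<open>r\<close> is bounded below, and there the steps are dominated by
  the terms of a convergent series.\<close>

lemma slowly_varying_tendsto_0:
  fixes h r \<gamma> :: "nat \<Rightarrow> real"
  assumes \<gamma>: "\<And>k. 0 \<le> \<gamma> k" "\<not> summable \<gamma>" "\<gamma> \<longlonglongrightarrow> 0"
    and r: "\<And>k. 0 \<le> r k" "summable (\<lambda>k. \<gamma> k * (r k)\<^sup>2)"
    and h: "\<And>k. 0 \<le> h k"
    and diff: "(\<lambda>k. h k - r k) \<longlonglongrightarrow> 0"
    and slow: "\<And>k. h (Suc k) \<le> h k + B * \<gamma> k"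
    and B: "0 < B"
  shows "h \<longlonglongrightarrow> 0"
proof (rule LIMSEQ_I)
  fix e :: real assume "0 < e"
  \<comment> \<open>The final bound on \<open>h\<close> is \<open>4 * \<eta>\<close>, which is
    strictly below \<open>e\<close>.\<close>
  define \<eta> where "\<eta> = e / 5"
  have \<eta>: "0 < \<eta>" using \<open>0 < e\<close> by (simp add: \<eta>_def)
  obtain m1 where m1: "\<And>k. k \<ge> m1 \<Longrightarrow> \<bar>h k - r k\<bar> < \<eta>"
    using LIMSEQ_D[OF diff \<eta>] by auto
  obtain m2 where m2: "\<And>k. k \<ge> m2 \<Longrightarrow> \<gamma> k < \<eta> / B"
    using LIMSEQ_D[OF \<gamma>(3), of "\<eta> / B"] \<eta> B by (auto simp: abs_less_iff)
  \<comment> \<open>The level \<open>\<eta> ^ 3 / B\<close> makes the tail at most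
    \<open>\<eta>\<close> after multiplication by \<open>B / \<eta>\<^sup>2\<close>.\<close>
  obtain m3 where m3: "\<And>k n. k \<ge> m3 \<Longrightarrow> norm (\<Sum>i=k..<n. \<gamma> i * (r i)\<^sup>2) < \<eta> ^ 3 / B"
    using r(2) \<eta> B unfolding summable_Cauchy by (meson divide_pos_pos zero_less_power)
  define m where "m = max m1 (max m2 m3)"
  \<comment> \<open>If not, \<open>r k \<ge> \<eta>\<close> from \<open>m\<close> on, and
    \<open>\<gamma>\<close> would be summable by comparison.\<close>
  have "\<exists>k\<ge>m. h k < 2 * \<eta>"
  proof (rule ccontr)
    assume "\<not> (\<exists>k\<ge>m. h k < 2 * \<eta>)"
    then have "r k \<ge> \<eta>" if "k \<ge> m" for k
      using m1[of k] that by (force simp: m_def not_less)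
    then have le: "norm (\<gamma> k) \<le> 1 / \<eta>\<^sup>2 * (\<gamma> k * (r k)\<^sup>2)" if "k \<ge> m" for k
      using that \<gamma>(1)[of k] \<eta> mult_left_mono[of "\<eta>\<^sup>2" "(r k)\<^sup>2" "\<gamma> k"]
      by (simp add: field_simps power_mono)
    have "summable (\<lambda>k. 1 / \<eta>\<^sup>2 * (\<gamma> k * (r k)\<^sup>2))"
      using r(2) by (rule summable_mult)
    then have "summable \<gamma>"
      using le summable_comparison_test[of \<gamma> "\<lambda>k. 1 / \<eta>\<^sup>2 * (\<gamma> k * (r k)\<^sup>2)"] by blast
    then show False using \<gamma>(2) by simp
  qed
  then obtain k0 where k0: "k0 \<ge> m" "h k0 < 2 * \<eta>" by auto
  \<comment> \<open>A step from below \<open>2 * \<eta>\<close> stays below \<open>3 * \<eta>\<close>; above \<open>2 * \<eta>\<close> we have \<open>r n \<ge> \<eta>\<close>, so the step is paid for by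
    the summable series.\<close>
  have "h n \<le> 3 * \<eta> + B / \<eta>\<^sup>2 * (\<Sum>i=k0..<n. \<gamma> i * (r i)\<^sup>2)" if "n \<ge> k0" for n
    using that
  proof (induction n rule: dec_induct)
    case base
    then show ?case using k0 \<eta> by simp
  next
    case (step n)
    have nonneg: "0 \<le> B / \<eta>\<^sup>2 * (\<Sum>i=k0..<Suc n. \<gamma> i * (r i)\<^sup>2)"
      using B \<gamma>(1) by (intro mult_nonneg_nonneg sum_nonneg) auto
    show ?case
    proof (cases "h n < 2 * \<eta>")
      case True
      have "B * \<gamma> n \<le> \<eta>"
        using m2[of n] k0(1) step.hyps B by (simp add: m_def field_simps)
      then show ?thesis using slow[of n] True nonneg by linarith
    next
      case False
      then have "r n \<ge> \<eta>"
        using m1[of n] k0(1) step.hyps by (simp add: m_def abs_less_iff)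
      then have "B * \<gamma> n \<le> B / \<eta>\<^sup>2 * (\<gamma> n * (r n)\<^sup>2)"
        using \<gamma>(1)[of n] \<eta> B mult_left_mono[of "\<eta>\<^sup>2" "(r n)\<^sup>2" "\<gamma> n"]
        by (simp add: field_simps power_mono)
      then show ?thesis
        using slow[of n] step by (simp add: algebra_simps)
    qed
  qed
  moreover have "B / \<eta>\<^sup>2 * (\<Sum>i=k0..<n. \<gamma> i * (r i)\<^sup>2) \<le> \<eta>" for n
  proof -
    have "(\<Sum>i=k0..<n. \<gamma> i * (r i)\<^sup>2) \<le> \<eta> ^ 3 / B"
      using m3[of k0 n] k0(1) by (auto simp: m_def abs_less_iff)
    then show ?thesis
      using \<eta> B by (simp add: field_simps power2_eq_square power3_eq_cube)
  qed
  ultimately have *: "h n \<le> 3 * \<eta> + \<eta>" if "n \<ge> k0" for n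
    using that by (blast intro: order_trans add_left_mono)
  show "\<exists>no. \<forall>n\<ge>no. norm (h n - 0) < e"
  proof (intro exI[of _ k0] allI impI)
    fix n assume "k0 \<le> n"
    from *[OF this] show "norm (h n - 0) < e"
      using h[of n] \<open>0 < e\<close> by (simp add: \<eta>_def)
  qed
qed

text \<open>Bounded sequences have cluster points, and continuity makes each of them a zero of
  \<open>\<phi>\<close>. That the zero set is nonempty is stated as well, because
  \<open>infdist\<close> to the empty set is 0 by convention.\<close>

lemma infdist_zero_set_tendsto_0:
  fixes x :: "nat \<Rightarrow> 'a::euclidean_space" and \<phi> :: "'a \<Rightarrow> 'b::real_normed_vector"
  assumes bdd: "bounded (range x)" and cont: "continuous_on UNIV \<phi>"
    and lim: "(\<lambda>k. \<phi> (x k)) \<longlonglongrightarrow> 0"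
  shows "{y. \<phi> y = 0} \<noteq> {}" "(\<lambda>k. infdist (x k) {y. \<phi> y = 0}) \<longlonglongrightarrow> 0"
proof -
  let ?C = "{y. \<phi> y = 0}"
  \<comment> \<open>Stated for an arbitrary subsequence: the identity gives a zero, and a
    subsequence that stays at distance \<open>e\<close> gives a contradiction.\<close>
  have cluster: "\<exists>l r'. strict_mono r' \<and> l \<in> ?C \<and> (\<lambda>k. x (r (r' k))) \<longlonglongrightarrow> l"
    if r: "strict_mono r" for r :: "nat \<Rightarrow> nat"
  proof -
    have "bounded (range (x \<circ> r))"
      using bdd by (rule bounded_subset) auto
    then obtain l r' where r': "strict_mono (r' :: nat \<Rightarrow> nat)" "(\<lambda>k. (x \<circ> r) (r' k)) \<longlonglongrightarrow> l"
      using bounded_imp_convergent_subsequence[of "x \<circ> r"] by (auto simp: o_def)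
    then have "(\<lambda>k. \<phi> (x (r (r' k)))) \<longlonglongrightarrow> \<phi> l"
      using cont by (auto intro: continuous_on_tendsto_compose)
    moreover have "(\<lambda>k. \<phi> (x (r (r' k)))) \<longlonglongrightarrow> 0"
      using LIMSEQ_subseq_LIMSEQ[OF lim strict_mono_o[OF r r'(1)]] by (simp add: o_def)
    ultimately have "\<phi> l = 0"
      by (rule LIMSEQ_unique)
    then show ?thesis using r' by auto
  qed
  show "?C \<noteq> {}"
    using cluster[OF strict_mono_id] by auto
  show "(\<lambda>k. infdist (x k) ?C) \<longlonglongrightarrow> 0"
  proof (rule ccontr)
    assume "\<not> ?thesis"
    then obtain e where e: "e > 0" "\<And>n. \<exists>k\<ge>n. infdist (x k) ?C \<ge> e"
      by (auto simp: LIMSEQ_def not_less abs_of_nonneg infdist_nonneg)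
    then have "infinite {k. infdist (x k) ?C \<ge> e}"
      by (auto simp: infinite_nat_iff_unbounded_le)
    then obtain r :: "nat \<Rightarrow> nat" where r: "strict_mono r" "\<And>k. infdist (x (r k)) ?C \<ge> e"
      using infinite_enumerate[of "{k. infdist (x k) ?C \<ge> e}"] by (auto simp: Ball_def)
    obtain l r' where l: "strict_mono r'" "l \<in> ?C" "(\<lambda>k. x (r (r' k))) \<longlonglongrightarrow> l"
      using cluster[OF r(1)] by auto
    have "(\<lambda>k. infdist (x (r (r' k))) ?C) \<longlonglongrightarrow> infdist l ?C"
      using l(3) by (rule tendsto_infdist)
    then have "e \<le> infdist l ?C"
      using r(2) by (intro LIMSEQ_le_const) auto
    then show False using l(2) e(1) by simp
  qed
qed

lemma Min_le_weighted_average: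
  fixes e w :: "nat \<Rightarrow> real"
  assumes w: "\<And>k. 0 < w k" and S: "(\<Sum>k=0..K. w k * e k) \<le> S"
  shows "(MIN k\<in>{0..K}. e k) \<le> S * inverse (\<Sum>k=0..K. w k)"
proof -
  let ?m = "MIN k\<in>{0..K}. e k"
  have pos: "0 < (\<Sum>k=0..K. w k)"
    using w by (intro sum_pos) auto
  have "?m * (\<Sum>k=0..K. w k) = (\<Sum>k=0..K. w k * ?m)"
    by (subst mult.commute) (rule sum_distrib_right)
  also have "\<dots> \<le> (\<Sum>k=0..K. w k * e k)"
    using w by (intro sum_mono mult_left_mono) (auto intro: less_imp_le)
  also note S
  finally show ?thesis using pos by (simp add: field_simps)
qed

text \<open>Cauchy-Schwarz, followed by the inequality between the product of two numbers and the
  mean of their squares.\<close>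

lemma inner_bound:
  assumes "(norm u)\<^sup>2 \<le> c" "(norm v)\<^sup>2 \<le> c"
  shows "\<bar>u \<bullet> v\<bar> \<le> c"
proof -
  have "\<bar>u \<bullet> v\<bar> \<le> norm u * norm v"
    by (rule Cauchy_Schwarz_ineq2)
  also have "2 * (norm u * norm v) \<le> (norm u)\<^sup>2 + (norm v)\<^sup>2"
    using sum_squares_bound[of "norm u" "norm v"] by simp
  finally show ?thesis using assms by simp
qed

text \<open>This leads back from logarithms: if \<open>ln v\<close> converges, then \<open>v\<close>
  is bounded, and dividing by it costs only a constant factor.\<close>

lemma summable_of_ratio:
  fixes v b :: "nat \<Rightarrow> real"
  assumes v: "\<And>k. 1 \<le> v k" and b: "\<And>k. 0 \<le> b k"
    and conv: "convergent (\<lambda>k. ln (v k))" and s: "summable (\<lambda>k. b k / v k)"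
  shows "convergent v" "summable b"
proof -
  have exp_ln: "exp (ln (v k)) = v k" for k
    using v[of k] by simp
  obtain l where "(\<lambda>k. ln (v k)) \<longlonglongrightarrow> l"
    using conv by (auto simp: convergent_def)
  then have "(\<lambda>k. exp (ln (v k))) \<longlonglongrightarrow> exp l"
    by (rule tendsto_exp)
  then show "convergent v"
    unfolding exp_ln by (rule convergentI)
  then obtain K where K: "\<And>k. \<bar>v k\<bar> \<le> K"
    using convergent_imp_Bseq[of v] by (auto simp: Bseq_def)
  have "norm (b k) \<le> K * (b k / v k)" for k
    using K[of k] v[of k] b[of k] mult_left_mono[of "v k" K "b k"] by (simp add: field_simps)
  then show "summable b"
    using s by (intro summable_comparison_test[of b "\<lambda>k. K * (b k / v k)"] summable_mult) auto
qed

section \<open>Almost sure summability of orthogonal increments\<close>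

text \<open>Partial sums frozen once they reach the level \<open>e\<close> in absolute value: the maximal inequality becomes
  Chebyshev's inequality for the last frozen sum.\<close>

primrec stopped_sum :: "real \<Rightarrow> (nat \<Rightarrow> real) \<Rightarrow> nat \<Rightarrow> real" where
  "stopped_sum e d 0 = 0"
| "stopped_sum e d (Suc n) =
     stopped_sum e d n + (if \<bar>stopped_sum e d n\<bar> < e then d n else 0)"

lemma stopped_sum_alt:
  assumes "0 < e"
  shows "(\<forall>j\<le>n. \<bar>\<Sum>i<j. d i\<bar> < e) \<and> stopped_sum e d n = (\<Sum>i<n. d i) \<or> e \<le> \<bar>stopped_sum e d n\<bar>"
  using assms by (induction n) (auto simp: le_Suc_eq not_le not_less)

lemma stopped_sum_ge:
  assumes "0 < e" "j \<le> n" "e \<le> \<bar>\<Sum>i<j. d i\<bar>"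
  shows "e \<le> \<bar>stopped_sum e d n\<bar>"
  using stopped_sum_alt[OF assms(1), of n d] assms(2,3) by (auto simp: not_less)

context prob_space
begin

text \<open>Whether the sum is already frozen at time \<open>k\<close> is decided by
  \<open>F k\<close>. The cross term in the square of the next frozen sum therefore integrates to 0,
  and the second moment grows by at most \<open>(c k)\<^sup>2\<close>. Orthogonality to bounded
  \<open>F k\<close>-measurable functions expresses the martingale property without conditional
  expectations.\<close>

lemma kolmogorov_maximal_inequality:
  fixes D :: "nat \<Rightarrow> 'a \<Rightarrow> real" and F :: "nat \<Rightarrow> 'a measure"
  assumes sub: "\<And>k. subalgebra M (F k)" "\<And>k. subalgebra (F (Suc k)) (F k)"
    and D: "\<And>k. D k \<in> borel_measurable (F (Suc k))"
    and bound: "\<And>k. AE \<omega> in M. \<bar>D k \<omega>\<bar> \<le> c k"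
    and orth: "\<And>k Y B. Y \<in> borel_measurable (F k) \<Longrightarrow> (AE \<omega> in M. \<bar>Y \<omega>\<bar> \<le> B) \<Longrightarrow>
                 (LINT \<omega>|M. Y \<omega> * D k \<omega>) = 0"
    and e: "0 < e"
  shows "prob {\<omega>\<in>space M. \<exists>j\<le>n. e \<le> \<bar>\<Sum>i<j. D i \<omega>\<bar>} \<le> (\<Sum>i<n. (c i)\<^sup>2) / e\<^sup>2"
proof -
  have DM[measurable]: "D k \<in> borel_measurable M" for k
    using D sub(1) measurable_from_subalg by blast
  define X where "X k \<omega> = stopped_sum e (\<lambda>i. D i \<omega>) k" for k \<omega>
  define J where "J k \<omega> = (if \<bar>X k \<omega>\<bar> < e then 1 else 0 :: real)" for k \<omega>
  have X_Suc: "X (Suc k) \<omega> = X k \<omega> + J k \<omega> * D k \<omega>" for k \<omega>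
    by (simp add: X_def J_def)
  have X_F: "X k \<in> borel_measurable (F k)" for k
  proof (induction k)
    case 0
    then show ?case by (simp add: X_def[abs_def])
  next
    case (Suc k)
    then have [measurable]: "X k \<in> borel_measurable (F (Suc k))" "D k \<in> borel_measurable (F (Suc k))"
      using sub(2) D measurable_from_subalg by blast+
    show ?case
      unfolding X_Suc[abs_def] J_def[abs_def] by measurable
  qed
  have [measurable]: "X k \<in> borel_measurable M" for k
    using X_F sub(1) measurable_from_subalg by blast
  \<comment> \<open>The bound may depend on \<open>k\<close>; it gives integrability and makes the
    cross factor admissible in \<open>orth\<close>.\<close>
  have X_bound: "\<exists>B. AE \<omega> in M. \<bar>X k \<omega>\<bar> \<le> B" for k
  proof (induction k)
    case 0
    then show ?case by (auto simp: X_def)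
  next
    case (Suc k)
    then obtain B where B: "AE \<omega> in M. \<bar>X k \<omega>\<bar> \<le> B" by auto
    have "AE \<omega> in M. \<bar>X (Suc k) \<omega>\<bar> \<le> B + c k"
      using B bound[of k] by eventually_elim (auto simp: X_Suc J_def)
    then show ?case by auto
  qed
  have X_sq_int: "integrable M (\<lambda>\<omega>. (X k \<omega>)\<^sup>2)" for k
  proof -
    obtain B where B: "AE \<omega> in M. \<bar>X k \<omega>\<bar> \<le> B"
      using X_bound by auto
    then have "AE \<omega> in M. norm ((X k \<omega>)\<^sup>2) \<le> B\<^sup>2"
      by eventually_elim (simp add: power2_le_iff_abs_le abs_le_square_iff[symmetric])
    then show ?thesis
      by (intro integrable_const_bound) auto
  qed
  have X_sq: "(LINT \<omega>|M. (X k \<omega>)\<^sup>2) \<le> (\<Sum>i<k. (c i)\<^sup>2)" for k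
  proof (induction k)
    case 0
    then show ?case by (simp add: X_def)
  next
    case (Suc k)
    obtain B where B: "AE \<omega> in M. \<bar>X k \<omega>\<bar> \<le> B"
      using X_bound by auto
    let ?Y = "\<lambda>\<omega>. 2 * X k \<omega> * J k \<omega>"
    have Y_F: "?Y \<in> borel_measurable (F k)"
      using X_F[of k] unfolding J_def by measurable
    then have [measurable]: "?Y \<in> borel_measurable M"
      using sub(1) measurable_from_subalg by blast
    have Y_bound: "AE \<omega> in M. \<bar>?Y \<omega>\<bar> \<le> 2 * B"
      using B by eventually_elim (auto simp: J_def abs_mult)
    have YD_int: "integrable M (\<lambda>\<omega>. ?Y \<omega> * D k \<omega>)"
    proof (rule integrable_const_bound)
      show "AE \<omega> in M. norm (?Y \<omega> * D k \<omega>) \<le> 2 * B * c k"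
        using Y_bound bound[of k]
        by eventually_elim (auto simp only: real_norm_def abs_mult[of "?Y _"] intro!: mult_mono)
    qed measurable
    have "AE \<omega> in M. (X (Suc k) \<omega>)\<^sup>2 \<le> (X k \<omega>)\<^sup>2 + ?Y \<omega> * D k \<omega> + (c k)\<^sup>2"
      using bound[of k]
    proof eventually_elim
      case (elim \<omega>)
      have "(J k \<omega> * D k \<omega>)\<^sup>2 \<le> (c k)\<^sup>2"
        using elim by (auto simp: J_def power2_le_iff_abs_le abs_le_square_iff[symmetric])
      then show ?case
        by (simp add: X_Suc power2_sum algebra_simps)
    qed
    then have "(LINT \<omega>|M. (X (Suc k) \<omega>)\<^sup>2) \<le> (LINT \<omega>|M. (X k \<omega>)\<^sup>2 + ?Y \<omega> * D k \<omega> + (c k)\<^sup>2)"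
      using X_sq_int YD_int by (intro integral_mono_AE) auto
    also have "\<dots> = (LINT \<omega>|M. (X k \<omega>)\<^sup>2) + (c k)\<^sup>2"
      using X_sq_int YD_int orth[OF Y_F Y_bound] by (simp add: prob_space)
    finally show ?case using Suc by simp
  qed
  have "prob {\<omega>\<in>space M. \<exists>j\<le>n. e \<le> \<bar>\<Sum>i<j. D i \<omega>\<bar>} \<le> prob {\<omega>\<in>space M. e\<^sup>2 \<le> (X n \<omega>)\<^sup>2}"
  proof (rule finite_measure_mono)
    show "{\<omega>\<in>space M. \<exists>j\<le>n. e \<le> \<bar>\<Sum>i<j. D i \<omega>\<bar>} \<subseteq> {\<omega>\<in>space M. e\<^sup>2 \<le> (X n \<omega>)\<^sup>2}"
      using stopped_sum_ge[OF e, where n = n] e by (auto simp: X_def abs_le_square_iff[symmetric])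
  qed measurable
  also have "\<dots> \<le> (LINT \<omega>|M. (X n \<omega>)\<^sup>2) / e\<^sup>2"
    using X_sq_int e by (intro integral_Markov_inequality_measure[of _ _ "{}"]) auto
  also have "\<dots> \<le> (\<Sum>i<n. (c i)\<^sup>2) / e\<^sup>2"
    using X_sq by (intro divide_right_mono) auto
  finally show ?thesis .
qed

text \<open>The maximal inequality for the increments from \<open>m\<close> on is controlled by a
  tail of the series of \<open>(c k)\<^sup>2\<close>. Hence almost surely the partial sums
  eventually stay within any given distance of one of them, so they are Cauchy.\<close>

lemma orthogonal_increments_summable:
  fixes D :: "nat \<Rightarrow> 'a \<Rightarrow> real" and F :: "nat \<Rightarrow> 'a measure"
  assumes sub: "\<And>k. subalgebra M (F k)" "\<And>k. subalgebra (F (Suc k)) (F k)"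
    and D: "\<And>k. D k \<in> borel_measurable (F (Suc k))"
    and bound: "\<And>k. AE \<omega> in M. \<bar>D k \<omega>\<bar> \<le> c k"
    and orth: "\<And>k Y B. Y \<in> borel_measurable (F k) \<Longrightarrow> (AE \<omega> in M. \<bar>Y \<omega>\<bar> \<le> B) \<Longrightarrow>
                 (LINT \<omega>|M. Y \<omega> * D k \<omega>) = 0"
    and c: "summable (\<lambda>k. (c k)\<^sup>2)"
  shows "AE \<omega> in M. summable (\<lambda>k. D k \<omega>)"
proof -
  have DM[measurable]: "D k \<in> borel_measurable M" for k
    using D sub(1) measurable_from_subalg by blast
  define tail where "tail m = (\<Sum>i. (c (i + m))\<^sup>2)" for m
  have tail: "tail \<longlonglongrightarrow> 0"
    using suminf_exist_split2[OF c] by (simp add: tail_def[abs_def])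
  define A where "A e m n = {\<omega>\<in>space M. \<exists>j\<le>n. e \<le> \<bar>\<Sum>i<j. D (i + m) \<omega>\<bar>}" for e m n
  have [measurable]: "A e m n \<in> sets M" for e m n
    unfolding A_def by measurable
  have A_le: "prob (A e m n) \<le> tail m / e\<^sup>2" if "0 < e" for e m n
  proof -
    have "prob (A e m n) \<le> (\<Sum>i<n. (c (i + m))\<^sup>2) / e\<^sup>2"
      unfolding A_def using that sub D bound orth
      by (intro kolmogorov_maximal_inequality[where F = "\<lambda>k. F (k + m)"]) auto
    also have "\<dots> \<le> tail m / e\<^sup>2"
      unfolding tail_def using c
      by (intro divide_right_mono sum_le_suminf) (auto simp: summable_iff_shift[of "\<lambda>k. (c k)\<^sup>2"])
    finally show ?thesis .
  qed
  \<comment> \<open>The events increase with \<open>n\<close>, so the bound passes to their union by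
    continuity from below.\<close>
  have UA_le: "prob (\<Union>n. A e m n) \<le> tail m / e\<^sup>2" if "0 < e" for e m
  proof (rule LIMSEQ_le_const2)
    show "(\<lambda>n. prob (A e m n)) \<longlonglongrightarrow> prob (\<Union>n. A e m n)"
      by (intro finite_Lim_measure_incseq) (auto simp: incseq_def A_def intro: order_trans)
  qed (use A_le[OF that] in auto)
  have null: "prob (\<Inter>m. \<Union>n. A e m n) = 0" if "0 < e" for e
  proof -
    have "prob (\<Inter>m. \<Union>n. A e m n) \<le> tail m / e\<^sup>2" for m
      using UA_le[OF that, of m] by (rule order_trans[rotated]) (intro finite_measure_mono; auto)
    moreover have "(\<lambda>m. tail m / e\<^sup>2) \<longlonglongrightarrow> 0"
      using tendsto_divide[OF tail tendsto_const[of "e\<^sup>2"]] that by simp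
    ultimately have "prob (\<Inter>m. \<Union>n. A e m n) \<le> 0"
      by (intro LIMSEQ_le_const[of "\<lambda>m. tail m / e\<^sup>2"]) auto
    then show ?thesis
      using measure_nonneg[of M] by (simp add: antisym)
  qed
  \<comment> \<open>Countably many levels suffice, which keeps the exceptional set null.\<close>
  have "AE \<omega> in M. \<forall>p::nat. \<omega> \<notin> (\<Inter>m. \<Union>n. A (1 / Suc p) m n)"
    unfolding AE_all_countable
  proof
    fix p :: nat
    have "(\<Inter>m. \<Union>n. A (1 / Suc p) m n) \<in> null_sets M"
      using null[of "1 / Suc p"] by (auto simp: null_sets_def emeasure_eq_measure)
    then show "AE \<omega> in M. \<omega> \<notin> (\<Inter>m. \<Union>n. A (1 / Suc p) m n)"
      by (rule AE_not_in)
  qed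
  then show ?thesis
    using AE_space
  proof eventually_elim
    case (elim \<omega>)
    define S where "S n = (\<Sum>i<n. D i \<omega>)" for n
    have "Cauchy S"
    proof (rule metric_CauchyI)
      fix e :: real assume "0 < e"
      then obtain p where p: "1 / Suc p < e / 2"
        using nat_approx_posE[of "e / 2"] by auto
      obtain m where m: "\<And>n. \<omega> \<notin> A (1 / Suc p) m n"
        using elim(1) by blast
      have "\<bar>S (j + m) - S m\<bar> < 1 / Suc p" for j
      proof -
        have "S (j + m) - S m = (\<Sum>i<j. D (i + m) \<omega>)"
          by (induction j) (auto simp: S_def)
        then show ?thesis
          using m[of j] elim(2) by (auto simp: A_def not_le)
      qed
      then have near: "\<bar>S n - S m\<bar> < e / 2" if "n \<ge> m" for n
        using p that by (metis add.commute le_add_diff_inverse less_trans)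
      have "dist (S n) (S n') < e" if "n \<ge> m" "n' \<ge> m" for n n'
        using near[OF that(1)] near[OF that(2)] unfolding dist_real_def by linarith
      then show "\<exists>m. \<forall>n\<ge>m. \<forall>n'\<ge>m. dist (S n) (S n') < e"
        by blast
    qed
    then show ?case
      by (simp add: summable_iff_convergent Cauchy_convergent_iff S_def[abs_def])
  qed
qed

end

section \<open>Stochastic gradient descent with drifting objectives\<close>

lemma subalgebra_vimage_algebra:
  assumes "f \<in> M \<rightarrow>\<^sub>M N"
  shows "subalgebra M (vimage_algebra (space M) f N)"
proof -
  have "(\<lambda>\<omega>. \<omega>) \<in> M \<rightarrow>\<^sub>M vimage_algebra (space M) f N"
    using assms by (intro measurable_vimage_algebra2) auto
  from measurable_sets[OF this] have "A \<in> sets M" if "A \<in> sets (vimage_algebra (space M) f N)" for A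
    using that sets.sets_into_space[OF that] by (metis inf.absorb_iff1 space_vimage_algebra vimage_ident)
  then show ?thesis
    by (auto simp: subalgebra_def)
qed

text \<open>\<open>G k y z\<close> is the stochastic gradient at \<open>y\<close>,
  \<open>h k\<close> its mean and \<open>V k\<close> the potential. The objectives enter through the
  inequalities \<open>descent\<close> and \<open>drift\<close>, so no derivative occurs here. The
  exceptional set in \<open>G_bound\<close> does not depend on \<open>k\<close> or \<open>y\<close>,
  so the bound may be evaluated at the random iterates.\<close>

locale stochastic_gradient = prob_space M for M :: "'w measure" +
  fixes S :: "'z measure" and N :: "'z measure" and Z :: "nat \<Rightarrow> 'w \<Rightarrow> 'z"
    and G :: "nat \<Rightarrow> 'e::euclidean_space \<Rightarrow> 'z \<Rightarrow> 'e" and h :: "nat \<Rightarrow> 'e \<Rightarrow> 'e"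
    and V :: "nat \<Rightarrow> 'e \<Rightarrow> real" and \<gamma> a :: "nat \<Rightarrow> real" and C L :: real
    and x0 :: 'e and x :: "nat \<Rightarrow> 'w \<Rightarrow> 'e"
  assumes N_prob: "prob_space N" and N_sets: "sets N = sets S"
    and Z_indep: "indep_vars (\<lambda>_. S) Z {1..}"
    and Z_law: "\<And>k. k \<ge> 1 \<Longrightarrow> distr M S (Z k) = N"
    and G_meas: "\<And>k. (\<lambda>(y, z). G k y z) \<in> borel_measurable (borel \<Otimes>\<^sub>M S)"
    and h_meas: "\<And>k. h k \<in> borel_measurable borel"
    and V_meas: "\<And>k. V k \<in> borel_measurable borel"
    and x_0: "\<And>\<omega>. \<omega> \<in> space M \<Longrightarrow> x 0 \<omega> = x0"
    and x_Suc: "\<And>k \<omega>. \<omega> \<in> space M \<Longrightarrow>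
       x (Suc k) \<omega> = x k \<omega> - \<gamma> k *\<^sub>R G k (x k \<omega>) (Z (Suc k) \<omega>)"
    and G_mean: "\<And>k y. (LINT z|N. G k y z) = h k y"
    and G_bound: "AE z in N. \<forall>k y. (norm (G k y z))\<^sup>2 \<le> C * V k y"
    and V_ge_1: "\<And>k y. 1 \<le> V k y"
    and descent: "\<And>k y d. V k (y + d) \<le> V k y + h k y \<bullet> d + L / 2 * (norm d)\<^sup>2"
    and drift: "\<And>k y. V (Suc k) y \<le> (1 + a k) * V k y"
    and C_nonneg: "0 \<le> C" and L_nonneg: "0 \<le> L"
    and a: "\<And>k. 0 \<le> a k" "summable a"
    and \<gamma>: "\<And>k. 0 \<le> \<gamma> k" "summable (\<lambda>k. (\<gamma> k)\<^sup>2)"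
begin

lemma V_pos: "0 < V k y"
  using V_ge_1[of k y] by simp

lemma Z_meas: "k \<ge> 1 \<Longrightarrow> Z k \<in> M \<rightarrow>\<^sub>M S"
  using Z_indep by (auto simp: indep_vars_def)

text \<open>The natural filtration of the samples. Indices start at 1: \<open>history 0\<close> is
  trivial, and \<open>Z (Suc k)\<close> is the fresh sample used in step \<open>k\<close>.\<close>

definition history :: "nat \<Rightarrow> 'w measure" where
  "history k = vimage_algebra (space M) (\<lambda>\<omega>. \<lambda>i\<in>{1..k}. Z i \<omega>) (\<Pi>\<^sub>M i\<in>{1..k}. S)"

lemma space_history [simp]: "space (history k) = space M"
  by (simp add: history_def)

lemma path_meas: "(\<lambda>\<omega>. \<lambda>i\<in>{1..k}. Z i \<omega>) \<in> M \<rightarrow>\<^sub>M (\<Pi>\<^sub>M i\<in>{1..k}. S)"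
  using Z_meas by (intro measurable_restrict) auto

lemma Z_history: "i \<in> {1..k} \<Longrightarrow> Z i \<in> history k \<rightarrow>\<^sub>M S"
proof -
  assume i: "i \<in> {1..k}"
  have "(\<lambda>\<omega>. \<lambda>i\<in>{1..k}. Z i \<omega>) \<in> history k \<rightarrow>\<^sub>M (\<Pi>\<^sub>M i\<in>{1..k}. S)"
    unfolding history_def using path_meas[THEN measurable_space]
    by (intro measurable_vimage_algebra1) auto
  from measurable_compose[OF this measurable_component_singleton[OF i]] i
  show "Z i \<in> history k \<rightarrow>\<^sub>M S" by simp
qed

lemma subalgebra_history: "subalgebra M (history k)" "subalgebra (history (Suc k)) (history k)"
proof -
  show "subalgebra M (history k)"
    unfolding history_def using path_meas by (rule subalgebra_vimage_algebra)
  have "(\<lambda>\<omega>. \<lambda>i\<in>{1..k}. Z i \<omega>) \<in> history (Suc k) \<rightarrow>\<^sub>M (\<Pi>\<^sub>M i\<in>{1..k}. S)"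
    using Z_history by (intro measurable_restrict) auto
  then have "subalgebra (history (Suc k)) (vimage_algebra (space (history (Suc k)))
      (\<lambda>\<omega>. \<lambda>i\<in>{1..k}. Z i \<omega>) (\<Pi>\<^sub>M i\<in>{1..k}. S))"
    by (rule subalgebra_vimage_algebra)
  then show "subalgebra (history (Suc k)) (history k)"
    by (simp add: history_def[of k])
qed

lemma history_measD: "f \<in> history k \<rightarrow>\<^sub>M A \<Longrightarrow> f \<in> M \<rightarrow>\<^sub>M A"
  using measurable_from_subalg[OF subalgebra_history(1)] .

text \<open>The pair is distributed on the history \<open>\<sigma>\<close>-algebra through the identity map, so that Fubini applies to
  integrands depending on the past in an arbitrary measurable way, without factorising them through
  \<open>Z 1, \<dots>, Z k\<close>.\<close>

lemma joint_law:
  "distr M (history k) (\<lambda>\<omega>. \<omega>) \<Otimes>\<^sub>M N =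
     distr M (history k \<Otimes>\<^sub>M S) (\<lambda>\<omega>. (\<omega>, Z (Suc k) \<omega>))"
proof -
  interpret N: prob_space N by (rule N_prob)
  let ?path = "\<lambda>I \<omega>. restrict (\<lambda>i. Z i \<omega>) I"
  \<comment> \<open>Independence of the past from the next sample is obtained by grouping the
    indices into two blocks labelled by Booleans.\<close>
  let ?P = "\<lambda>b. if b then {1..k} else {Suc k}"
  have "indep_vars (\<lambda>b. PiM (?P b) (\<lambda>_. S)) (\<lambda>b. ?path (?P b)) UNIV"
    using Z_indep by (rule indep_vars_restrict) (auto simp: disjoint_family_on_def)
  moreover have "(\<lambda>b. PiM (?P b) (\<lambda>_. S)) = case_bool (PiM {1..k} (\<lambda>_. S)) (PiM {Suc k} (\<lambda>_. S))"
    "(\<lambda>b. ?path (?P b)) = case_bool (?path {1..k}) (?path {Suc k})"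
    by (auto split: bool.split)
  ultimately have ind: "indep_var (PiM {1..k} (\<lambda>_. S)) (?path {1..k}) (PiM {Suc k} (\<lambda>_. S)) (?path {Suc k})"
    unfolding indep_var_def by simp
  have id_meas: "(\<lambda>\<omega>. \<omega>) \<in> M \<rightarrow>\<^sub>M history k"
    using measurable_from_subalg[OF subalgebra_history(1) measurable_ident] by (simp add: id_def)
  have Z: "Z (Suc k) \<in> M \<rightarrow>\<^sub>M S"
    by (rule Z_meas) simp
  have pair_meas: "(\<lambda>\<omega>. (\<omega>, Z (Suc k) \<omega>)) \<in> M \<rightarrow>\<^sub>M history k \<Otimes>\<^sub>M S"
    using id_meas Z by (rule measurable_Pair)
  interpret H: prob_space "distr M (history k) (\<lambda>\<omega>. \<omega>)"
    by (rule prob_space_distr[OF id_meas])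
  show ?thesis
  proof (rule pair_measure_eqI)
    fix A B assume "A \<in> sets (distr M (history k) (\<lambda>\<omega>. \<omega>))" "B \<in> sets N"
    then have A: "A \<in> sets (history k)" and B: "B \<in> sets S"
      by (auto simp: N_sets)
    have AM: "A \<subseteq> space M"
      using sets.sets_into_space[OF A] by simp
    \<comment> \<open>An event of the history is the preimage of an event \<open>A'\<close> for the
      path of past samples; \<open>B'\<close> rewrites \<open>B\<close> in the same way for the path
      over the single index \<open>Suc k\<close>.\<close>
    obtain A' where A': "A' \<in> sets (PiM {1..k} (\<lambda>_. S))" "A = ?path {1..k} -` A' \<inter> space M"
      using A path_meas[THEN measurable_space] unfolding history_def
      by (subst (asm) sets_vimage_algebra2) auto
    define B' where "B' = (\<lambda>y. y (Suc k)) -` B \<inter> space (PiM {Suc k} (\<lambda>_. S))"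
    have "B' \<in> sets (PiM {Suc k} (\<lambda>_. S))"
      unfolding B'_def using B by (intro measurable_sets[OF measurable_component_singleton]) auto
    from indep_varD[OF ind A'(1) this]
    have "prob ((\<lambda>\<omega>. (?path {1..k} \<omega>, ?path {Suc k} \<omega>)) -` (A' \<times> B') \<inter> space M) =
      prob A * prob (?path {Suc k} -` B' \<inter> space M)"
      by (simp add: A'(2))
    also have "?path {Suc k} -` B' \<inter> space M = Z (Suc k) -` B \<inter> space M"
      using measurable_space[OF Z] by (auto simp: B'_def space_PiM)
    also have "(\<lambda>\<omega>. (?path {1..k} \<omega>, ?path {Suc k} \<omega>)) -` (A' \<times> B') \<inter> space M =
        A \<inter> (Z (Suc k) -` B \<inter> space M)"
      using measurable_space[OF Z] by (auto simp: A'(2) B'_def space_PiM)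
    finally have "prob (A \<inter> (Z (Suc k) -` B \<inter> space M)) = prob A * prob (Z (Suc k) -` B \<inter> space M)" .
    moreover have "A \<inter> (Z (Suc k) -` B \<inter> space M) = (\<lambda>\<omega>. (\<omega>, Z (Suc k) \<omega>)) -` (A \<times> B) \<inter> space M"
      by auto
    moreover have "emeasure N B = emeasure M (Z (Suc k) -` B \<inter> space M)"
      using emeasure_distr[OF Z B] Z_law[of "Suc k"] by simp
    moreover have "emeasure (distr M (history k) (\<lambda>\<omega>. \<omega>)) A = emeasure M A"
      using emeasure_distr[OF id_meas A] AM by (simp add: Int_absorb2)
    ultimately show "emeasure (distr M (history k) (\<lambda>\<omega>. \<omega>)) A * emeasure N B =
        emeasure (distr M (history k \<Otimes>\<^sub>M S) (\<lambda>\<omega>. (\<omega>, Z (Suc k) \<omega>))) (A \<times> B)"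
      using A B emeasure_distr[OF pair_meas, of "A \<times> B"]
      by (simp add: emeasure_eq_measure ennreal_mult)
  next
    show "sets (distr M (history k) (\<lambda>\<omega>. \<omega>) \<Otimes>\<^sub>M N) =
        sets (distr M (history k \<Otimes>\<^sub>M S) (\<lambda>\<omega>. (\<omega>, Z (Suc k) \<omega>)))"
      using sets_pair_measure_cong[OF sets_distr N_sets] by simp
  qed (fact H.sigma_finite_measure_axioms N.sigma_finite_measure_axioms)+
qed

lemma x_history: "x k \<in> borel_measurable (history k)"
proof (induction k)
  case 0
  have "(\<lambda>_. x0) \<in> borel_measurable (history 0)" by simp
  then show ?case
    by (rule measurable_cong[THEN iffD1, rotated]) (simp add: x_0)
next
  case (Suc k)
  have [measurable]: "x k \<in> borel_measurable (history (Suc k))"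
    using Suc subalgebra_history(2) measurable_from_subalg by blast
  have [measurable]: "Z (Suc k) \<in> history (Suc k) \<rightarrow>\<^sub>M S"
    by (rule Z_history) simp
  note [measurable] = G_meas
  have "(\<lambda>\<omega>. x k \<omega> - \<gamma> k *\<^sub>R G k (x k \<omega>) (Z (Suc k) \<omega>)) \<in> borel_measurable (history (Suc k))"
    by measurable
  then show ?case
    by (rule measurable_cong[THEN iffD1, rotated]) (simp add: x_Suc)
qed

lemma x_meas [measurable]: "x k \<in> borel_measurable M"
  using x_history by (rule history_measD)

lemma G_int: "integrable N (G k y)"
proof -
  interpret N: prob_space N by (rule N_prob)
  have "AE z in N. norm (G k y z) \<le> sqrt (C * V k y)"
    using G_bound by eventually_elim (auto intro: real_le_rsqrt)
  moreover have "G k y \<in> borel_measurable N"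
    using measurable_compose[OF measurable_Pair1' G_meas[of k]]
    by (simp add: N_sets cong: measurable_cong_sets)
  ultimately show ?thesis
    by (intro N.integrable_const_bound) auto
qed

text \<open>The norm of a mean is at most the mean of the norms, which \<open>G_bound\<close>
  estimates by \<open>sqrt (C * V k y)\<close>.\<close>

lemma h_bound: "(norm (h k y))\<^sup>2 \<le> C * V k y"
proof -
  interpret N: prob_space N by (rule N_prob)
  have "norm (h k y) \<le> (LINT z|N. norm (G k y z))"
    using integral_norm_bound[of N "G k y"] by (simp add: G_mean)
  also have "\<dots> \<le> sqrt (C * V k y)"
    using G_bound G_int[of k y]
    by (intro N.integral_le_const) (auto elim!: eventually_mono intro: real_le_rsqrt)
  finally have "(norm (h k y))\<^sup>2 \<le> (sqrt (C * V k y))\<^sup>2"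
    by (rule power_mono) simp
  then show ?thesis
    using C_nonneg V_pos[of k y] by (simp add: less_imp_le)
qed

text \<open>\<open>G_bound\<close> carried over to the sample space through the law of
  \<open>Z\<close>. The point \<open>y\<close> is quantified inside the almost sure statement, so it
  may be replaced by an iterate.\<close>

lemma G_path_bound: "AE \<omega> in M. \<forall>k j y. (norm (G j y (Z (Suc k) \<omega>)))\<^sup>2 \<le> C * V j y"
proof (subst AE_all_countable, rule allI)
  fix k
  show "AE \<omega> in M. \<forall>j y. (norm (G j y (Z (Suc k) \<omega>)))\<^sup>2 \<le> C * V j y"
    using G_bound Z_law[of "Suc k"] Z_meas[of "Suc k"]
    by (intro AE_distrD[of "Z (Suc k)" M S]) auto
qed

text \<open>Division by \<open>V\<close> makes the increments bounded by a constant multiple of \<open>\<gamma> k\<close>, however large the iterates.\<close>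

definition noise :: "nat \<Rightarrow> 'w \<Rightarrow> real" where
  "noise k \<omega> = \<gamma> k * (h k (x k \<omega>) \<bullet> (h k (x k \<omega>) - G k (x k \<omega>) (Z (Suc k) \<omega>))) / V k (x k \<omega>)"

lemma noise_history: "noise k \<in> borel_measurable (history (Suc k))"
proof -
  have [measurable]: "x k \<in> borel_measurable (history (Suc k))"
    using x_history subalgebra_history(2) measurable_from_subalg by blast
  have [measurable]: "Z (Suc k) \<in> history (Suc k) \<rightarrow>\<^sub>M S"
    by (rule Z_history) simp
  note [measurable] = G_meas h_meas V_meas
  show ?thesis
    unfolding noise_def[abs_def] by measurable
qed

lemma noise_bound: "AE \<omega> in M. \<forall>k. \<bar>noise k \<omega>\<bar> \<le> 2 * C * \<gamma> k"
  using G_path_bound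
proof eventually_elim
  case (elim \<omega>)
  show ?case
  proof
    fix k
    let ?h = "h k (x k \<omega>)" and ?G = "G k (x k \<omega>) (Z (Suc k) \<omega>)" and ?v = "V k (x k \<omega>)"
    have "(norm ?G)\<^sup>2 \<le> C * ?v"
      using elim by blast
    then have "\<bar>?h \<bullet> ?G\<bar> \<le> C * ?v" "\<bar>?h \<bullet> ?h\<bar> \<le> C * ?v"
      using h_bound by (blast intro: inner_bound)+
    then have "\<bar>?h \<bullet> ?h - ?h \<bullet> ?G\<bar> \<le> 2 * C * ?v"
      unfolding abs_le_iff by linarith
    then have "\<gamma> k * \<bar>?h \<bullet> ?h - ?h \<bullet> ?G\<bar> / ?v \<le> \<gamma> k * (2 * C * ?v) / ?v"
      using \<gamma> V_pos by (intro divide_right_mono mult_left_mono) (auto intro: less_imp_le)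
    also have "\<dots> = 2 * C * \<gamma> k"
      using V_pos[of k "x k \<omega>"] by simp
    finally show "\<bar>noise k \<omega>\<bar> \<le> 2 * C * \<gamma> k"
      using \<gamma> V_pos[of k "x k \<omega>"] by (simp add: noise_def inner_diff_right abs_mult)
  qed
qed

text \<open>Fubini for the joint law of the past and the fresh sample: with the past fixed, the
  increment integrates to 0 because \<open>h\<close> is the mean of \<open>G\<close>. The bound on
  \<open>Y\<close> provides integrability.\<close>

lemma noise_orthogonal:
  assumes Y: "Y \<in> borel_measurable (history k)" and B: "AE \<omega> in M. \<bar>Y \<omega>\<bar> \<le> B"
  shows "(LINT \<omega>|M. Y \<omega> * noise k \<omega>) = 0"
proof -
  interpret N: prob_space N by (rule N_prob)
  define MH where "MH = distr M (history k) (\<lambda>\<omega>. \<omega>)"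
  have id_meas: "(\<lambda>\<omega>. \<omega>) \<in> M \<rightarrow>\<^sub>M history k"
    using measurable_from_subalg[OF subalgebra_history(1) measurable_ident] by (simp add: id_def)
  interpret MH: prob_space MH
    unfolding MH_def by (rule prob_space_distr[OF id_meas])
  interpret P: pair_prob_space MH N ..
  \<comment> \<open>The integrand as a function of the past and of a separate variable for the fresh
    sample.\<close>
  define \<psi> where "\<psi> = (\<lambda>(\<omega>, z). Y \<omega> * (\<gamma> k * (h k (x k \<omega>) \<bullet> (h k (x k \<omega>) - G k (x k \<omega>) z)) / V k (x k \<omega>)))"
  note [measurable] = G_meas h_meas V_meas Y x_history
  have \<psi>_meas: "\<psi> \<in> borel_measurable (history k \<Otimes>\<^sub>M S)"
    unfolding \<psi>_def by measurable
  have pair_meas: "(\<lambda>\<omega>. (\<omega>, Z (Suc k) \<omega>)) \<in> M \<rightarrow>\<^sub>M history k \<Otimes>\<^sub>M S"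
    using id_meas Z_meas by (intro measurable_Pair) auto
  have joint: "MH \<Otimes>\<^sub>M N = distr M (history k \<Otimes>\<^sub>M S) (\<lambda>\<omega>. (\<omega>, Z (Suc k) \<omega>))"
    unfolding MH_def by (rule joint_law)
  have Yn: "Y \<omega> * noise k \<omega> = \<psi> (\<omega>, Z (Suc k) \<omega>)" for \<omega>
    by (simp add: \<psi>_def noise_def)
  have [measurable]: "Y \<in> borel_measurable M" "noise k \<in> borel_measurable M"
    using Y noise_history by (blast intro: history_measD)+
  have "integrable M (\<lambda>\<omega>. Y \<omega> * noise k \<omega>)"
  proof (rule integrable_const_bound)
    show "AE \<omega> in M. norm (Y \<omega> * noise k \<omega>) \<le> B * (2 * C * \<gamma> k)"
      using B noise_bound by eventually_elim (auto simp: abs_mult intro!: mult_mono)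
  qed measurable
  then have \<psi>_int: "integrable (MH \<Otimes>\<^sub>M N) \<psi>"
    unfolding joint using \<psi>_meas pair_meas by (simp add: integrable_distr_eq Yn)
  have inner_0: "(LINT z|N. \<psi> (\<omega>, z)) = 0" for \<omega>
  proof -
    have "(LINT z|N. h k (x k \<omega>) \<bullet> (h k (x k \<omega>) - G k (x k \<omega>) z)) =
        h k (x k \<omega>) \<bullet> (h k (x k \<omega>) - (LINT z|N. G k (x k \<omega>) z))"
      using G_int[of k "x k \<omega>"]
      by (simp add: inner_diff_right N.prob_space)
    then show ?thesis
      by (simp add: \<psi>_def G_mean)
  qed
  have "(LINT \<omega>|M. Y \<omega> * noise k \<omega>) = integral\<^sup>L (MH \<Otimes>\<^sub>M N) \<psi>"
    unfolding joint using \<psi>_meas pair_meas by (simp add: integral_distr Yn)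
  also have "\<dots> = (LINT \<omega>|MH. LINT z|N. \<psi> (\<omega>, z))"
    using P.integral_fst'[OF \<psi>_int] by simp
  also have "\<dots> = 0"
    by (simp add: inner_0)
  finally show ?thesis .
qed

lemma noise_summable: "AE \<omega> in M. summable (\<lambda>k. noise k \<omega>)"
proof (rule orthogonal_increments_summable)
  show "AE \<omega> in M. \<bar>noise k \<omega>\<bar> \<le> 2 * C * \<gamma> k" for k
    using noise_bound by eventually_elim simp
  show "summable (\<lambda>k. (2 * C * \<gamma> k)\<^sup>2)"
    using \<gamma>(2) by (simp add: power_mult_distrib summable_mult)
qed (fact subalgebra_history noise_history noise_orthogonal)+

text \<open>The inequality \<open>descent\<close> is used with the displacement
  \<open>- \<gamma> k *\<^sub>R G\<close>. Writing \<open>G\<close> as \<open>h - (h - G)\<close>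
  splits its linear term into the decrease and \<open>V\<close> times the noise;
  \<open>drift\<close> then changes the parameter.\<close>

lemma one_step:
  "AE \<omega> in M. \<forall>k. V (Suc k) (x (Suc k) \<omega>) \<le> (1 + a k) * (V k (x k \<omega>) +
     (V k (x k \<omega>) * noise k \<omega> - \<gamma> k * (norm (h k (x k \<omega>)))\<^sup>2 + L * C / 2 * (\<gamma> k)\<^sup>2 * V k (x k \<omega>)))"
  using G_path_bound AE_space
proof eventually_elim
  case (elim \<omega>)
  show ?case
  proof
    fix k
    let ?h = "h k (x k \<omega>)" and ?G = "G k (x k \<omega>) (Z (Suc k) \<omega>)" and ?v = "V k (x k \<omega>)"
    have "V k (x (Suc k) \<omega>) \<le> ?v + ?h \<bullet> (- \<gamma> k *\<^sub>R ?G) + L / 2 * (norm (- \<gamma> k *\<^sub>R ?G))\<^sup>2"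
      using descent[of k "x k \<omega>" "- \<gamma> k *\<^sub>R ?G"] x_Suc[OF elim(2)] by simp
    also have "?h \<bullet> (- \<gamma> k *\<^sub>R ?G) = ?v * noise k \<omega> - \<gamma> k * (norm ?h)\<^sup>2"
    proof -
      have "?v * noise k \<omega> = \<gamma> k * (?h \<bullet> (?h - ?G))"
        using V_pos[of k "x k \<omega>"] by (simp add: noise_def)
      then show ?thesis
        by (simp add: inner_diff_right power2_norm_eq_inner algebra_simps)
    qed
    also have "L / 2 * (norm (- \<gamma> k *\<^sub>R ?G))\<^sup>2 = L / 2 * (\<gamma> k)\<^sup>2 * (norm ?G)\<^sup>2"
      by (simp add: power_mult_distrib)
    also have "\<dots> \<le> L / 2 * (\<gamma> k)\<^sup>2 * (C * ?v)"
      using elim(1) L_nonneg by (intro mult_left_mono) auto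
    finally have "V k (x (Suc k) \<omega>) \<le> ?v + (?v * noise k \<omega> - \<gamma> k * (norm ?h)\<^sup>2 + L * C / 2 * (\<gamma> k)\<^sup>2 * ?v)"
      by (simp add: algebra_simps)
    then show "V (Suc k) (x (Suc k) \<omega>) \<le> (1 + a k) * (?v + (?v * noise k \<omega> - \<gamma> k * (norm ?h)\<^sup>2 + L * C / 2 * (\<gamma> k)\<^sup>2 * ?v))"
      using drift[of k "x (Suc k) \<omega>"] a(1)[of k]
      by (meson add_nonneg_nonneg mult_left_mono order_trans zero_le_one)
  qed
qed

lemma summable_perturbation: "summable (\<lambda>k. a k + L * C / 2 * (\<gamma> k)\<^sup>2)"
  using a(2) \<gamma>(2) by (intro summable_add summable_mult)

text \<open>After division by \<open>V\<close> and passage to logarithms the noise is an additive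
  summable term. Since \<open>V\<close> is at least 1, the logarithms are bounded below by
  0.\<close>

lemma pathwise_convergence:
  "AE \<omega> in M. convergent (\<lambda>k. V k (x k \<omega>)) \<and> summable (\<lambda>k. \<gamma> k * (norm (h k (x k \<omega>)))\<^sup>2)"
  using one_step noise_summable
proof eventually_elim
  case (elim \<omega>)
  let ?v = "\<lambda>k. V k (x k \<omega>)" and ?b = "\<lambda>k. \<gamma> k * (norm (h k (x k \<omega>)))\<^sup>2"
  have "ln (?v (Suc k)) \<le> ln (?v k) + (a k + L * C / 2 * (\<gamma> k)\<^sup>2) - ?b k / ?v k + noise k \<omega>" for k
    using multiplicative_recursion_ln[OF V_pos V_pos a(1) elim(1)[rule_format, of k]] V_pos[of k "x k \<omega>"]
    by (simp add: add_divide_distrib diff_divide_distrib)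
  note * = perturbed_decreasing_convergent[OF this _ _ summable_perturbation elim(2), of 0]
  have "convergent (\<lambda>k. ln (?v k))" "summable (\<lambda>k. ?b k / ?v k)"
    using V_ge_1 V_pos \<gamma>(1) by (auto intro!: * divide_nonneg_pos)
  then show ?case
    using V_ge_1 \<gamma>(1) summable_of_ratio[of ?v ?b] by auto
qed

text \<open>The starting point is deterministic and each step has bounded relative noise, so
  induction gives an essential bound for each \<open>k\<close>. It may grow with \<open>k\<close>;
  it serves to justify taking expectations.\<close>

lemma V_path_bound: "\<exists>B. AE \<omega> in M. V k (x k \<omega>) \<le> B"
proof (induction k)
  case 0
  have "AE \<omega> in M. V 0 (x 0 \<omega>) \<le> V 0 x0"
    by (rule AE_I2) (simp add: x_0)
  then show ?case by blast
next
  case (Suc k)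
  then obtain B where B: "AE \<omega> in M. V k (x k \<omega>) \<le> B" by auto
  have "AE \<omega> in M. V (Suc k) (x (Suc k) \<omega>) \<le> (1 + a k) * (B + (B * (2 * C * \<gamma> k) + L * C / 2 * (\<gamma> k)\<^sup>2 * B))"
    using B one_step noise_bound
  proof eventually_elim
    case (elim \<omega>)
    have "V k (x k \<omega>) * noise k \<omega> \<le> B * (2 * C * \<gamma> k)"
    proof -
      have "V k (x k \<omega>) * noise k \<omega> \<le> V k (x k \<omega>) * (2 * C * \<gamma> k)"
        using elim(3) V_pos[of k "x k \<omega>"] by (intro mult_left_mono) (auto simp: abs_le_iff)
      also have "\<dots> \<le> B * (2 * C * \<gamma> k)"
        using elim(1) C_nonneg \<gamma>(1)[of k] by (intro mult_right_mono) auto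
      finally show ?thesis .
    qed
    moreover have "L * C / 2 * (\<gamma> k)\<^sup>2 * V k (x k \<omega>) \<le> L * C / 2 * (\<gamma> k)\<^sup>2 * B"
      using elim(1) L_nonneg C_nonneg by (intro mult_left_mono) auto
    moreover have "0 \<le> \<gamma> k * (norm (h k (x k \<omega>)))\<^sup>2"
      using \<gamma>(1) by simp
    ultimately have "V k (x k \<omega>) + (V k (x k \<omega>) * noise k \<omega> - \<gamma> k * (norm (h k (x k \<omega>)))\<^sup>2
        + L * C / 2 * (\<gamma> k)\<^sup>2 * V k (x k \<omega>)) \<le> B + (B * (2 * C * \<gamma> k) + L * C / 2 * (\<gamma> k)\<^sup>2 * B)"
      using elim(1) by linarith
    from mult_left_mono[OF this, of "1 + a k"] elim(2) a(1)[of k] show ?case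
      by (smt (verit))
  qed
  then show ?case by blast
qed

lemma V_int: "integrable M (\<lambda>\<omega>. V k (x k \<omega>))"
proof -
  note [measurable] = V_meas
  obtain B where "AE \<omega> in M. V k (x k \<omega>) \<le> B"
    using V_path_bound by auto
  then have "AE \<omega> in M. norm (V k (x k \<omega>)) \<le> B"
    by eventually_elim (use V_pos in \<open>simp add: abs_of_pos\<close>)
  then show ?thesis
    by (rule integrable_const_bound) measurable
qed

lemma integrable_norm_h_sq: "integrable M (\<lambda>\<omega>. (norm (h k (x k \<omega>)))\<^sup>2)"
proof -
  note [measurable] = h_meas
  show ?thesis
    by (rule Bochner_Integration.integrable_bound[OF integrable_mult_right[OF V_int, of C k]])
      (use h_bound C_nonneg V_pos in \<open>auto simp: abs_of_pos abs_mult\<close>)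
qed

text \<open>The noise has mean 0 even when weighted by \<open>V k (x k \<omega>)\<close>, which is
  bounded and measurable in the history. The logarithmic argument then applies to the expected
  potential.\<close>

lemma summable_expectation: "summable (\<lambda>k. \<gamma> k * (LINT \<omega>|M. (norm (h k (x k \<omega>)))\<^sup>2))"
proof -
  define v where "v k = (LINT \<omega>|M. V k (x k \<omega>))" for k
  define b where "b k = \<gamma> k * (LINT \<omega>|M. (norm (h k (x k \<omega>)))\<^sup>2)" for k
  have v1: "1 \<le> v k" for k
    unfolding v_def using V_int V_ge_1 by (intro integral_ge_const) auto
  have b0: "0 \<le> b k" for k
    unfolding b_def using \<gamma>(1) by simp
  have rec: "v (Suc k) \<le> (1 + a k) * (v k + (L * C / 2 * (\<gamma> k)\<^sup>2 * v k - b k))" for k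
  proof -
    note [measurable] = V_meas
    have [measurable]: "noise k \<in> borel_measurable M"
      using noise_history by (rule history_measD)
    have V_hist: "(\<lambda>\<omega>. V k (x k \<omega>)) \<in> borel_measurable (history k)"
      using measurable_compose[OF x_history V_meas] .
    obtain B where "AE \<omega> in M. V k (x k \<omega>) \<le> B"
      using V_path_bound by auto
    then have B: "AE \<omega> in M. \<bar>V k (x k \<omega>)\<bar> \<le> B"
      by eventually_elim (use V_pos in \<open>simp add: abs_of_pos\<close>)
    have Vn_int: "integrable M (\<lambda>\<omega>. V k (x k \<omega>) * noise k \<omega>)"
    proof (rule integrable_const_bound)
      show "AE \<omega> in M. norm (V k (x k \<omega>) * noise k \<omega>) \<le> B * (2 * C * \<gamma> k)"
        using B noise_bound by eventually_elim (auto simp: abs_mult intro!: mult_mono)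
    qed measurable
    have "v (Suc k) \<le> (LINT \<omega>|M. (1 + a k) * (V k (x k \<omega>) + (V k (x k \<omega>) * noise k \<omega>
        - \<gamma> k * (norm (h k (x k \<omega>)))\<^sup>2 + L * C / 2 * (\<gamma> k)\<^sup>2 * V k (x k \<omega>))))"
      unfolding v_def using one_step V_int integrable_norm_h_sq Vn_int
      by (intro integral_mono_AE) (auto elim: eventually_mono)
    also have "\<dots> = (1 + a k) * (v k + (L * C / 2 * (\<gamma> k)\<^sup>2 * v k - b k))"
      using V_int integrable_norm_h_sq Vn_int noise_orthogonal[OF V_hist B]
      by (simp add: v_def b_def)
    finally show ?thesis .
  qed
  have pos: "0 < v k" for k
    using v1[of k] by simp
  \<comment> \<open>The trailing 0 fills the place of the noise series.\<close>
  have "ln (v (Suc k)) \<le> ln (v k) + (a k + L * C / 2 * (\<gamma> k)\<^sup>2) - b k / v k + 0" for k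
    using multiplicative_recursion_ln[OF pos pos a(1) rec[of k]] pos[of k]
    by (simp add: diff_divide_distrib)
  note * = perturbed_decreasing_convergent[OF this _ _ summable_perturbation summable_zero, of 0]
  have "convergent (\<lambda>k. ln (v k))" "summable (\<lambda>k. b k / v k)"
    using v1 pos b0 by (auto intro!: * divide_nonneg_pos)
  then have "summable b"
    using v1 b0 by (intro summable_of_ratio(2)[of v b])
  then show ?thesis
    by (simp add: b_def[abs_def])
qed

end

section \<open>Gradients, orthogonal averages and parameter families\<close>

text \<open>The values of the derivative on the basis are the coordinates of a gradient vector. Such
  a vector thus exists, and the choice in \<open>gradient\<close> is meaningful.\<close>

lemma GDERIV_gradient:
  fixes f :: "'a::euclidean_space \<Rightarrow> real"
  assumes "(f has_derivative f') (at x)"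
  shows "GDERIV f x :> gradient f x" "h \<bullet> gradient f x = f' h"
proof -
  interpret f': linear f'
    using assms by (rule has_derivative_linear)
  have "f' h = h \<bullet> (\<Sum>b\<in>Basis. f' b *\<^sub>R b)" for h
    using f'.sum[of "\<lambda>b. (h \<bullet> b) *\<^sub>R b" Basis]
    by (simp add: euclidean_representation f'.scale inner_sum_right mult.commute)
  then have "f' = (\<lambda>h. h \<bullet> (\<Sum>b\<in>Basis. f' b *\<^sub>R b))"
    by (rule ext)
  with assms have "GDERIV f x :> (\<Sum>b\<in>Basis. f' b *\<^sub>R b)"
    by (simp add: gderiv_def)
  then show *: "GDERIV f x :> gradient f x"
    unfolding gradient_def by (rule someI)
  show "h \<bullet> gradient f x = f' h"
    using has_derivative_unique[OF *[unfolded gderiv_def] assms] by (rule fun_cong)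
qed

lemma gradient_eqI:
  fixes f :: "'a::euclidean_space \<Rightarrow> real"
  assumes "GDERIV f x :> D"
  shows "gradient f x = D"
  using GDERIV_gradient(2)[OF assms[unfolded gderiv_def]] by (auto intro: vector_eq_ldot[THEN iffD1])

text \<open>Along the segment from \<open>x\<close> to \<open>x + d\<close>, the function minus its
  linear and quadratic bound has nonpositive derivative on the unit interval, by the Lipschitz
  condition.\<close>

lemma lipschitz_gradient_upper:
  fixes f :: "'a::real_inner \<Rightarrow> real"
  assumes f: "\<And>x. GDERIV f x :> D x" and D: "L-lipschitz_on UNIV D"
  shows "f (x + d) \<le> f x + D x \<bullet> d + L / 2 * (norm d)\<^sup>2"
proof -
  define \<phi> where "\<phi> t = f (x + t *\<^sub>R d) - t * (D x \<bullet> d) - L / 2 * t\<^sup>2 * (norm d)\<^sup>2" for t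
  have \<phi>': "(\<phi> has_real_derivative ((D (x + t *\<^sub>R d) - D x) \<bullet> d - L * t * (norm d)\<^sup>2)) (at t)" for t
  proof -
    have "((\<lambda>t. x + t *\<^sub>R d) has_derivative (\<lambda>h. h *\<^sub>R d)) (at t)"
      by (auto intro!: derivative_eq_intros)
    then have "((\<lambda>t. f (x + t *\<^sub>R d)) has_derivative (\<lambda>h. (h *\<^sub>R d) \<bullet> D (x + t *\<^sub>R d))) (at t)"
      using has_derivative_compose f[unfolded gderiv_def] by blast
    then have "((\<lambda>t. f (x + t *\<^sub>R d)) has_real_derivative (D (x + t *\<^sub>R d) \<bullet> d)) (at t)"
      by (simp add: has_field_derivative_def inner_commute mult.commute[of _ "_ \<bullet> _"])
    then show ?thesis
      unfolding \<phi>_def[abs_def]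
      by (auto intro!: derivative_eq_intros simp: inner_diff_left)
  qed
  have "\<phi> 1 \<le> \<phi> 0"
  proof (rule DERIV_nonpos_imp_nonincreasing[of 0 1])
    fix t :: real assume t: "0 \<le> t" "t \<le> 1"
    have "(D (x + t *\<^sub>R d) - D x) \<bullet> d \<le> norm (D (x + t *\<^sub>R d) - D x) * norm d"
      by (rule norm_cauchy_schwarz)
    also have "\<dots> \<le> (L * (t * norm d)) * norm d"
      using lipschitz_onD[OF D, of "x + t *\<^sub>R d" x] t by (intro mult_right_mono) (auto simp: dist_norm)
    finally show "\<exists>y. (\<phi> has_real_derivative y) (at t) \<and> y \<le> 0"
      using \<phi>' by (intro exI conjI) (auto simp: power2_eq_square algebra_simps)
  qed simp
  then show ?thesis by (simp add: \<phi>_def)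
qed

lemma lipschitz_gradient_quadratic:
  fixes f :: "'a::real_inner \<Rightarrow> real"
  assumes f: "\<And>x. GDERIV f x :> D x" and D: "L-lipschitz_on UNIV D"
  shows "\<bar>f (x + d) - f x - D x \<bullet> d\<bar> \<le> L / 2 * (norm d)\<^sup>2"
proof -
  have "L-lipschitz_on UNIV (\<lambda>x. - D x)"
    using D by (simp add: lipschitz_on_def dist_minus)
  then have "- f (x + d) \<le> - f x + (- D x) \<bullet> d + L / 2 * (norm d)\<^sup>2"
    using f by (intro lipschitz_gradient_upper[where D = "\<lambda>x. - D x"] GDERIV_minus)
  then show ?thesis
    using lipschitz_gradient_upper[OF f D, of x d] unfolding abs_le_iff inner_minus_left by linarith
qed

text \<open>A quadratic error is \<open>o(norm d)\<close>. This identifies the gradient of an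
  average from an estimate that can be integrated.\<close>

lemma GDERIV_of_quadratic_bound:
  fixes f :: "'a::real_inner \<Rightarrow> real"
  assumes bound: "\<And>d. \<bar>f (x + d) - f x - D \<bullet> d\<bar> \<le> C * (norm d)\<^sup>2"
  shows "GDERIV f x :> D"
  unfolding gderiv_def
proof (rule has_derivativeI_sandwich[of 1])
  show "bounded_linear (\<lambda>h. h \<bullet> D)"
    by (rule bounded_linear_inner_left)
  show "norm (f y - f x - (y - x) \<bullet> D) / norm (y - x) \<le> C * norm (y - x)"
    if "y \<noteq> x" for y
    using bound[of "y - x"] that
    by (simp add: field_simps power2_eq_square inner_commute)
  show "((\<lambda>y. C * norm (y - x)) \<longlongrightarrow> 0) (at x)"
    by (auto intro!: tendsto_eq_intros)
qed simp

lemma continuous_on_matrix_vector_mult: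
  fixes A :: "'b::topological_space \<Rightarrow> real^'n^'m"
  assumes "continuous_on S A" "continuous_on S v"
  shows "continuous_on S (\<lambda>p. A p *v v p)"
  unfolding matrix_vector_mult_def using assms by (intro continuous_intros)

lemma continuous_on_transpose:
  fixes A :: "'b::topological_space \<Rightarrow> real^'n^'m"
  assumes "continuous_on S A"
  shows "continuous_on S (\<lambda>p. transpose (A p))"
  unfolding transpose_def using assms by (intro continuous_intros)

lemma norm_orthogonal_matrix_mult:
  fixes R :: "real^'n^'n"
  assumes "orthogonal_matrix R"
  shows "norm (R *v x) = norm x" "norm (transpose R *v x) = norm x"
proof -
  have "norm (A *v x) = norm x" if "orthogonal_matrix A" for A :: "real^'n^'n"
    using that orthogonal_transformation_matrix[of "(*v) A"]
    by (simp add: orthogonal_transformation_norm)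
  then show "norm (R *v x) = norm x" "norm (transpose R *v x) = norm x"
    using assms by (simp_all add: orthogonal_matrix_transpose del: transpose_matrix_vector)
qed

lemma inner_transpose_mult:
  fixes R :: "real^'n^'m"
  shows "(transpose R *v v) \<bullet> d = v \<bullet> (R *v d)"
  by (metis dot_lmul_matrix transpose_matrix_vector)

locale orthogonal_average = prob_space \<pi> for \<pi> :: "(real^'n^'n) measure" +
  assumes sets_pi [measurable_cong, simp]: "sets \<pi> = sets borel"
    and orth: "AE R in \<pi>. orthogonal_matrix R"
begin

text \<open>Orthogonal matrices carry the full measure, so a bound on them is enough.\<close>

lemma integrable_continuous:
  fixes \<phi> :: "real^'n^'n \<Rightarrow> 'b::euclidean_space"
  assumes "continuous_on UNIV \<phi>" "\<And>R. orthogonal_matrix R \<Longrightarrow> norm (\<phi> R) \<le> B"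
  shows "integrable \<pi> \<phi>"
proof (rule integrable_const_bound)
  show "AE R in \<pi>. norm (\<phi> R) \<le> B"
    using orth by eventually_elim (rule assms)
  show "\<phi> \<in> borel_measurable \<pi>"
    using assms(1) by (simp add: borel_measurable_continuous_onI cong: measurable_cong_sets)
qed

context
  fixes u :: "real^'n \<Rightarrow> real" and D :: "real^'n \<Rightarrow> real^'n" and L :: real
  assumes u: "\<And>y. GDERIV u y :> D y" and D: "L-lipschitz_on UNIV D"
begin

lemma continuous_potential: "continuous_on UNIV u"
  using u[unfolded gderiv_def] has_derivative_continuous
  by (intro continuous_at_imp_continuous_on) blast

lemma norm_le_affine: "norm (D y) \<le> norm (D 0) + L * norm y"
  using lipschitz_onD[OF D, of y 0] norm_triangle_ineq2[of "D y" "D 0"] by (auto simp: dist_norm)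

lemma integrable_potential: "integrable \<pi> (\<lambda>R. u (R *v y))"
proof (rule integrable_continuous)
  show "continuous_on UNIV (\<lambda>R. u (R *v y))"
    by (intro continuous_on_compose2[OF continuous_potential] continuous_on_matrix_vector_mult
        continuous_intros) auto
  fix R :: "real^'n^'n" assume R: "orthogonal_matrix R"
  have "\<bar>D 0 \<bullet> (R *v y)\<bar> \<le> norm (D 0) * norm y"
    using Cauchy_Schwarz_ineq2[of "D 0" "R *v y"] norm_orthogonal_matrix_mult[OF R] by simp
  moreover have "\<bar>u (R *v y) - u 0 - D 0 \<bullet> (R *v y)\<bar> \<le> L / 2 * (norm y)\<^sup>2"
    using lipschitz_gradient_quadratic[OF u D, of 0 "R *v y"] norm_orthogonal_matrix_mult[OF R]
    by simp
  ultimately show "norm (u (R *v y)) \<le> \<bar>u 0\<bar> + norm (D 0) * norm y + L / 2 * (norm y)\<^sup>2"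
    unfolding real_norm_def by linarith
qed

lemma integrable_gradient: "integrable \<pi> (\<lambda>R. transpose R *v D (R *v y))"
proof (rule integrable_continuous)
  show "continuous_on UNIV (\<lambda>R. transpose R *v D (R *v y))"
    by (intro continuous_on_compose2[OF lipschitz_on_continuous_on[OF D]]
        continuous_on_matrix_vector_mult continuous_on_transpose continuous_intros) auto
  fix R :: "real^'n^'n" assume R: "orthogonal_matrix R"
  then show "norm (transpose R *v D (R *v y)) \<le> norm (D 0) + L * norm y"
    using norm_le_affine[of "R *v y"]
    by (simp add: norm_orthogonal_matrix_mult del: transpose_matrix_vector)
qed

text \<open>Integrating the quadratic estimate of the Lipschitz gradient gives the derivative of the average
  without a theorem on differentiation under the integral.\<close>

lemma GDERIV_average:
  "GDERIV (\<lambda>y. LINT R|\<pi>. u (R *v y)) y :> (LINT R|\<pi>. transpose R *v D (R *v y))"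
proof (rule GDERIV_of_quadratic_bound)
  fix d :: "real^'n"
  let ?q = "\<lambda>R. u (R *v (y + d)) - u (R *v y) - (transpose R *v D (R *v y)) \<bullet> d"
  have q_int: "integrable \<pi> ?q"
    using integrable_potential integrable_gradient by auto
  have "\<bar>LINT R|\<pi>. ?q R\<bar> \<le> (LINT R|\<pi>. \<bar>?q R\<bar>)"
    by (rule integral_abs_bound)
  also have "\<dots> \<le> L / 2 * (norm d)\<^sup>2"
  proof (rule integral_le_const)
    show "integrable \<pi> (\<lambda>R. \<bar>?q R\<bar>)"
      using q_int by simp
    show "AE R in \<pi>. \<bar>?q R\<bar> \<le> L / 2 * (norm d)\<^sup>2"
      using orth
    proof eventually_elim
      case (elim R)
      then show ?case
        using lipschitz_gradient_quadratic[OF u D, of "R *v y" "R *v d"]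
        by (simp add: norm_orthogonal_matrix_mult inner_transpose_mult matrix_vector_right_distrib
            del: transpose_matrix_vector)
    qed
  qed
  finally show "\<bar>(LINT R|\<pi>. u (R *v (y + d))) - (LINT R|\<pi>. u (R *v y)) -
      (LINT R|\<pi>. transpose R *v D (R *v y)) \<bullet> d\<bar> \<le> L / 2 * (norm d)\<^sup>2"
    using integrable_potential integrable_gradient by simp
qed

text \<open>Orthogonal matrices and their transposes are isometries, so almost every integrand has
  the same Lipschitz constant \<open>L\<close>.\<close>

lemma lipschitz_average_gradient:
  "L-lipschitz_on UNIV (\<lambda>y. LINT R|\<pi>. transpose R *v D (R *v y))"
proof (rule lipschitz_onI)
  fix y z :: "real^'n"
  let ?q = "\<lambda>R. transpose R *v D (R *v y) - transpose R *v D (R *v z)"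
  have q_int: "integrable \<pi> ?q"
    using integrable_gradient by auto
  have "norm (LINT R|\<pi>. ?q R) \<le> (LINT R|\<pi>. norm (?q R))"
    by (rule integral_norm_bound)
  also have "\<dots> \<le> L * dist y z"
  proof (rule integral_le_const)
    show "integrable \<pi> (\<lambda>R. norm (?q R))"
      using q_int by simp
    show "AE R in \<pi>. norm (?q R) \<le> L * dist y z"
      using orth
    proof eventually_elim
      case (elim R)
      then show ?case
        using lipschitz_onD[OF D, of "R *v y" "R *v z"]
        by (simp add: norm_orthogonal_matrix_mult dist_norm del: transpose_matrix_vector
            flip: matrix_vector_mult_diff_distrib)
    qed
  qed
  finally show "dist (LINT R|\<pi>. transpose R *v D (R *v y)) (LINT R|\<pi>. transpose R *v D (R *v z)) \<le> L * dist y z"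
    using integrable_gradient by (simp add: dist_norm)
qed (use lipschitz_on_nonneg[OF D] in auto)

end

end

text \<open>The partial derivatives come from composing the joint derivative \<open>g'\<close> with
  affine embeddings of each factor. As \<open>g'\<close> is itself differentiable, it is continuous,
  and this makes the gradient jointly continuous in point and parameter.\<close>

lemma C2_family_derivatives:
  fixes g :: "real \<Rightarrow> 'a::euclidean_space \<Rightarrow> real"
  assumes "C2_on (UNIV \<times> {0<..}) (\<lambda>(y, s). g s y)"
  shows "\<And>s y. 0 < s \<Longrightarrow> GDERIV (g s) y :> gradient (g s) y"
    and "\<And>s y. 0 < s \<Longrightarrow> ((\<lambda>t. g t y) has_real_derivative deriv (\<lambda>t. g t y) s) (at s)"
    and "continuous_on (UNIV \<times> {0<..}) (\<lambda>(y, s). gradient (g s) y)"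
proof -
  obtain g' :: "'a \<times> real \<Rightarrow> ('a \<times> real) \<Rightarrow>\<^sub>L real" where
    g': "\<And>y s. 0 < s \<Longrightarrow> ((\<lambda>(y, s). g s y) has_derivative blinfun_apply (g' (y, s))) (at (y, s))"
    and g'_C1: "C1_on (UNIV \<times> {0<..}) g'"
    using assms unfolding C2_on_def by auto
  have "open (UNIV \<times> {0<..} :: ('a \<times> real) set)"
    by (intro open_Times) auto
  then have g'_cont: "continuous_on (UNIV \<times> {0<..}) g'"
    using g'_C1 unfolding C1_on_def
    by (intro continuous_at_imp_continuous_on) (blast intro: has_derivative_continuous)
  have y_deriv: "(g s has_derivative (\<lambda>h. g' (y, s) (h, 0))) (at y)" if "0 < s" for s y
  proof -
    have "((\<lambda>y. (y, s)) has_derivative (\<lambda>h. (h, 0))) (at y)"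
      by (intro derivative_intros)
    from has_derivative_compose[OF this g'[OF that]] show ?thesis by simp
  qed
  show "GDERIV (g s) y :> gradient (g s) y" if "0 < s" for s y
    using GDERIV_gradient(1)[OF y_deriv[OF that]] .
  show "((\<lambda>t. g t y) has_real_derivative deriv (\<lambda>t. g t y) s) (at s)" if "0 < s" for s y
  proof -
    have "((\<lambda>t. (y, t)) has_derivative (\<lambda>h. (0, h))) (at s)"
      by (intro derivative_intros)
    from has_derivative_compose[OF this g'[OF that]]
    have "(\<lambda>t. g t y) differentiable (at s)"
      by (auto simp: differentiable_def)
    then show ?thesis
      by (metis DERIV_imp_deriv real_differentiableE)
  qed
  have "gradient (g s) y = (\<Sum>b\<in>Basis. g' (y, s) (b, 0) *\<^sub>R b)" if "0 < s" for s y
    using GDERIV_gradient(2)[OF y_deriv[OF that]] euclidean_representation[of "gradient (g s) y"]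
    by (simp add: inner_commute)
  moreover have "continuous_on (UNIV \<times> {0<..}) (\<lambda>p. \<Sum>b\<in>Basis. g' p (b, 0) *\<^sub>R b)"
    using g'_cont by (intro continuous_intros)
  ultimately show "continuous_on (UNIV \<times> {0<..}) (\<lambda>(y, s). gradient (g s) y)"
    by (elim continuous_on_eq) auto
qed

lemma bounded_derivative_family_diff:
  fixes g :: "real \<Rightarrow> 'a \<Rightarrow> real"
  assumes g': "\<And>s. s \<in> {a..b} \<Longrightarrow> ((\<lambda>t. g t y) has_real_derivative deriv (\<lambda>t. g t y) s) (at s)"
    and bound: "\<And>s. s \<in> {a..b} \<Longrightarrow> \<bar>deriv (\<lambda>t. g t y) s\<bar> \<le> B"
    and s: "s \<in> {a..b}" "t \<in> {a..b}"
  shows "\<bar>g s y - g t y\<bar> \<le> B * \<bar>s - t\<bar>"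
  using field_differentiable_bound[of "{a..b}" "\<lambda>t. g t y" "deriv (\<lambda>t. g t y)" B s t] s
    has_field_derivative_at_within[OF g'] bound by simp

text \<open>Joint continuity is uniform on the product of a ball with the parameter interval, which
  is compact.\<close>

lemma uniform_parameter_limit:
  fixes \<phi> :: "'a::euclidean_space \<Rightarrow> real \<Rightarrow> 'b::metric_space"
  assumes cont: "continuous_on (UNIV \<times> {a..b}) (\<lambda>(y, s). \<phi> y s)"
    and \<sigma>: "\<And>k. \<sigma> k \<in> {a..b}" "\<sigma> \<longlonglongrightarrow> l" "l \<in> {a..b}" and "0 < e"
  shows "\<forall>\<^sub>F k in sequentially. \<forall>y\<in>cball 0 r. dist (\<phi> y (\<sigma> k)) (\<phi> y l) < e"
proof -
  have "uniformly_continuous_on (cball 0 r \<times> {a..b}) (\<lambda>(y, s). \<phi> y s)"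
    by (intro compact_uniformly_continuous continuous_on_subset[OF cont] compact_Times) auto
  then obtain d where d: "0 < d" "\<And>y s t. y \<in> cball 0 r \<Longrightarrow> s \<in> {a..b} \<Longrightarrow> t \<in> {a..b} \<Longrightarrow>
      dist s t < d \<Longrightarrow> dist (\<phi> y s) (\<phi> y t) < e"
    unfolding uniformly_continuous_on_def using \<open>0 < e\<close>
    by (force simp: dist_Pair_Pair)
  have "\<forall>\<^sub>F k in sequentially. dist (\<sigma> k) l < d"
    using \<sigma>(2) d(1) by (rule tendstoD)
  then show ?thesis
    by eventually_elim (use d(2) \<sigma> in blast)
qed

section \<open>Convergence of the iteration\<close>

text \<open>\<open>infdist\<close> to the empty set and the integral of a non-integrable function
  are both 0 by convention. The conjuncts \<open>crit (F \<epsilon>) \<noteq> {}\<close> and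
  \<open>integrable\<close> rule these cases out, so the distance and the expectations have their
  intended meaning.\<close>

theorem theoremB1:
  fixes f :: "real^'d \<Rightarrow> real"
    and g :: "real \<Rightarrow> real^'d \<Rightarrow> real"
    and \<sigma> \<gamma> :: "nat \<Rightarrow> real"
    and \<epsilon> L\<^sub>f L\<^sub>g c\<^sub>0 C\<^sub>0 M\<^sub>g lam gbar :: real
    and \<pi> :: "(real^'d^'d) measure"
    and H :: "(real^'d^'d) set"
    and M :: "'w measure"
    and Q :: "nat \<Rightarrow> 'w \<Rightarrow> real^'d^'d"
    and x0 :: "real^'d"
    and x :: "nat \<Rightarrow> 'w \<Rightarrow> real^'d"
    and F :: "real \<Rightarrow> real^'d \<Rightarrow> real"
  assumes f_C1: "C1_on UNIV f"
    and f_bdd: "bdd_below (range f)"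
    and f_suban: "subanalytic_on UNIV f"
    and f_lip: "L\<^sub>f-lipschitz_on UNIV (gradient f)"
    and sigma_dec: "\<And>k. \<sigma> (Suc k) \<le> \<sigma> k"
    and sigma_lim: "\<sigma> \<longlonglongrightarrow> \<epsilon>"
    and eps_pos: "\<epsilon> > 0"
    and g_C2: "C2_on (UNIV \<times> {0<..}) (\<lambda>(y, s). g s y)"
    and g_suban: "subanalytic_on (UNIV \<times> {0<..}) (\<lambda>(y, s). g s y)"
    and g_lip: "\<And>s. s \<in> {\<epsilon>..\<sigma> 0} \<Longrightarrow> L\<^sub>g-lipschitz_on UNIV (gradient (g s))"
    and consts_pos: "c\<^sub>0 > 0" "C\<^sub>0 > 0" "M\<^sub>g > 0"
    and g_coercive: "\<And>y s. s \<in> {\<epsilon>..\<sigma> 0} \<Longrightarrow> g s y \<ge> c\<^sub>0 * (norm y)\<^sup>2 - C\<^sub>0"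
    and g_dsigma: "\<And>y s. s \<in> {\<epsilon>..\<sigma> 0} \<Longrightarrow> \<bar>deriv (\<lambda>t. g t y) s\<bar> \<le> M\<^sub>g * (1 + (norm y)\<^sup>2)"
    and lam_pos: "lam > 0"
    and pi_prob: "prob_space \<pi>" "sets \<pi> = sets borel"
    and pi_supp: "subgroup H orthogonal_group" "AE R in \<pi>. R \<in> H"
    and M_prob: "prob_space M"
    and Q_indep: "prob_space.indep_vars M (\<lambda>_. borel) Q {1..}"
    and Q_law: "\<And>k. k \<ge> 1 \<Longrightarrow> distr M borel (Q k) = \<pi>"
    and gamma_bd: "\<And>k. 0 < \<gamma> k" "\<And>k. \<gamma> k \<le> gbar"
    and gbar: "(L\<^sub>f + lam * L\<^sub>g) * gbar < 2"
    and gamma_sum: "\<not> summable \<gamma>" "summable (\<lambda>k. (\<gamma> k)\<^sup>2)"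
    and x_0: "\<And>\<omega>. \<omega> \<in> space M \<Longrightarrow> x 0 \<omega> = x0"
    and x_Suc: "\<And>k \<omega>. \<omega> \<in> space M \<Longrightarrow>
       x (Suc k) \<omega> = x k \<omega> - \<gamma> k *\<^sub>R (gradient f (x k \<omega>) +
         lam *\<^sub>R (x k \<omega> -
           transpose (Q (Suc k) \<omega>) *v denoiser g (\<sigma> k) (Q (Suc k) \<omega> *v x k \<omega>)))"
    and F_def: "F = objective f lam \<pi> g"
  shows "(AE \<omega> in M. bounded (range (\<lambda>k. x k \<omega>))) \<and>
    (AE \<omega> in M. convergent (\<lambda>k. F \<epsilon> (x k \<omega>))) \<and>
    (AE \<omega> in M. summable (\<lambda>k. \<gamma> k * (norm (gradient (F (\<sigma> k)) (x k \<omega>)))\<^sup>2)) \<and>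
    (AE \<omega> in M. (\<lambda>k. norm (gradient (F \<epsilon>) (x k \<omega>))) \<longlonglongrightarrow> 0) \<and>
    crit (F \<epsilon>) \<noteq> {} \<and>
    (AE \<omega> in M. (\<lambda>k. infdist (x k \<omega>) (crit (F \<epsilon>))) \<longlonglongrightarrow> 0) \<and>
    (AE \<omega> in M. (\<lambda>k. norm (x (Suc k) \<omega> - x k \<omega>)) \<longlonglongrightarrow> 0) \<and>
    (\<forall>k. integrable M (\<lambda>\<omega>. (norm (gradient (F (\<sigma> k)) (x k \<omega>)))\<^sup>2)) \<and>
    (\<lambda>K. MIN k\<in>{0..K}. LINT \<omega>|M. (norm (gradient (F (\<sigma> k)) (x k \<omega>)))\<^sup>2)
      \<in> O(\<lambda>K. inverse (\<Sum>k=0..K. \<gamma> k))"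
proof -

  \<comment> \<open>Orthogonal averaging and the parameter interval\<close>
  interpret M: prob_space M by (rule M_prob)
  interpret \<pi>: prob_space \<pi> by (rule pi_prob(1))
  have orth: "AE R in \<pi>. orthogonal_matrix R"
    using pi_supp(2) subgroup.subset[OF pi_supp(1)]
    by (auto simp: orthogonal_group_def elim!: eventually_mono)
  interpret A: orthogonal_average \<pi>
    using pi_prob(2) orth by unfold_locales

  have dec: "decseq \<sigma>"
    using sigma_dec by (rule decseq_SucI)
  have \<sigma>_I: "\<sigma> k \<in> {\<epsilon>..\<sigma> 0}" for k
    using decseq_ge[OF dec sigma_lim] decseqD[OF dec, of 0 k] by simp
  have \<epsilon>_I: "\<epsilon> \<in> {\<epsilon>..\<sigma> 0}"
    using \<sigma>_I[of 0] by simp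
  have I_pos: "0 < s" if "s \<in> {\<epsilon>..\<sigma> 0}" for s
    using that eps_pos by simp

  \<comment> \<open>Gradients of the averaged objectives\<close>
  have f_GDERIV: "GDERIV f y :> gradient f y" for y
    using f_C1 GDERIV_gradient(1) unfolding C1_on_def by blast
  note g_deriv = C2_family_derivatives[OF g_C2]
  have g_GDERIV: "GDERIV (g s) y :> gradient (g s) y" if "s \<in> {\<epsilon>..\<sigma> 0}" for s y
    using g_deriv(1) I_pos that by blast
  have g_cont: "continuous_on (UNIV \<times> {\<epsilon>..\<sigma> 0}) (\<lambda>(y, s). gradient (g s) y)"
    using g_deriv(3) by (rule continuous_on_subset) (use I_pos in auto)
  have Lf: "0 \<le> L\<^sub>f" and Lg: "0 \<le> L\<^sub>g"
    using lipschitz_on_nonneg[OF f_lip] lipschitz_on_nonneg[OF g_lip[OF \<epsilon>_I]] .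

  define L where "L = L\<^sub>f + lam * L\<^sub>g"
  have L: "0 \<le> L"
    using Lf Lg lam_pos by (simp add: L_def)
  define gbar_grad where "gbar_grad s y = (LINT R|\<pi>. transpose R *v gradient (g s) (R *v y))" for s y
  note avg = A.GDERIV_average[OF g_GDERIV g_lip] A.lipschitz_average_gradient[OF g_GDERIV g_lip]
    A.integrable_potential[OF g_GDERIV g_lip] A.integrable_gradient[OF g_GDERIV g_lip]
  have F_GDERIV: "GDERIV (F s) y :> gradient f y + lam *\<^sub>R gbar_grad s y" if "s \<in> {\<epsilon>..\<sigma> 0}" for s y
  proof -
    have "GDERIV (\<lambda>y. avg_pot \<pi> g s y) y :> gbar_grad s y"
      unfolding gbar_grad_def avg_pot_def using that by (intro avg(1))
    from GDERIV_mult[OF GDERIV_const this, of lam]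
    have "GDERIV (\<lambda>y. lam * avg_pot \<pi> g s y) y :> lam *\<^sub>R gbar_grad s y"
      by simp
    then show ?thesis
      unfolding F_def objective_def[abs_def] using GDERIV_add[OF f_GDERIV] by fastforce
  qed
  have F_grad: "gradient (F s) y = gradient f y + lam *\<^sub>R gbar_grad s y" if "s \<in> {\<epsilon>..\<sigma> 0}" for s y
    using F_GDERIV[OF that] by (rule gradient_eqI)
  have F_lip: "L-lipschitz_on UNIV (gradient (F s))" if "s \<in> {\<epsilon>..\<sigma> 0}" for s
  proof -
    have "L-lipschitz_on UNIV (\<lambda>y. gradient f y + lam *\<^sub>R gbar_grad s y)"
      unfolding L_def gbar_grad_def using lam_pos that
      by (intro lipschitz_intros f_lip lipschitz_on_cmult_real[THEN lipschitz_on_le] avg(2)) auto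
    then show ?thesis
      using F_grad[OF that] by (simp add: fun_eq_iff[symmetric] cong: lipschitz_on_cong)
  qed

  \<comment> \<open>The shifted objective and its coercivity\<close>
  obtain mf where mf: "\<And>y. mf \<le> f y"
    using f_bdd by (auto simp: bdd_below_def)
  \<comment> \<open>\<open>mf - lam * C\<^sub>0\<close> is a lower bound of \<open>F s\<close> for
    all parameters in the interval; the added 1 gives a potential that is at least 1.\<close>
  define V where "V s y = F s y - (mf - lam * C\<^sub>0) + 1" for s y
  have V_ge: "1 + lam * c\<^sub>0 * (norm y)\<^sup>2 \<le> V s y" if "s \<in> {\<epsilon>..\<sigma> 0}" for s y
  proof -
    have "c\<^sub>0 * (norm y)\<^sup>2 - C\<^sub>0 \<le> avg_pot \<pi> g s y"
      unfolding avg_pot_def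
    proof (rule \<pi>.integral_ge_const)
      show "integrable \<pi> (\<lambda>R. g s (R *v y))"
        using avg(3) that by blast
      show "AE R in \<pi>. c\<^sub>0 * (norm y)\<^sup>2 - C\<^sub>0 \<le> g s (R *v y)"
        using orth by eventually_elim (use g_coercive[OF that] norm_orthogonal_matrix_mult(1) in metis)
    qed
    then have "lam * (c\<^sub>0 * (norm y)\<^sup>2 - C\<^sub>0) \<le> lam * avg_pot \<pi> g s y"
      using lam_pos by simp
    then show ?thesis
      using mf[of y] by (simp add: V_def F_def objective_def algebra_simps)
  qed
  have V_ge_1: "1 \<le> V s y" if "s \<in> {\<epsilon>..\<sigma> 0}" for s y
  proof -
    have "0 \<le> lam * c\<^sub>0 * (norm y)\<^sup>2"
      using lam_pos consts_pos by simp
    then show ?thesis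
      using V_ge[OF that, of y] by linarith
  qed
  \<comment> \<open>The summand 1 pays for the constant by \<open>V \<ge> 1\<close>, the other
    summand for the square of the norm by coercivity.\<close>
  define C1 where "C1 = 1 + 1 / (lam * c\<^sub>0)"
  have C1: "0 < C1"
    using lam_pos consts_pos by (simp add: C1_def add_pos_pos)
  have norm_le_V: "1 + (norm y)\<^sup>2 \<le> C1 * V s y" if "s \<in> {\<epsilon>..\<sigma> 0}" for s y
  proof -
    have pos: "0 < lam * c\<^sub>0"
      using lam_pos consts_pos by simp
    have "lam * c\<^sub>0 * (norm y)\<^sup>2 \<le> V s y"
      using V_ge[OF that, of y] by simp
    then have "(norm y)\<^sup>2 \<le> 1 / (lam * c\<^sub>0) * V s y"
      using pos by (simp add: field_simps)
    then show ?thesis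
      using V_ge_1[OF that, of y] by (simp add: C1_def distrib_right)
  qed

  \<comment> \<open>Dependence of the objective on the parameter\<close>
  have F_diff: "\<bar>F s y - F t y\<bar> \<le> lam * M\<^sub>g * \<bar>s - t\<bar> * (1 + (norm y)\<^sup>2)"
    if st: "s \<in> {\<epsilon>..\<sigma> 0}" "t \<in> {\<epsilon>..\<sigma> 0}" for s t y
  proof -
    have int: "integrable \<pi> (\<lambda>R. g s (R *v y))" "integrable \<pi> (\<lambda>R. g t (R *v y))"
      using avg(3) st by blast+
    have "\<bar>LINT R|\<pi>. g s (R *v y) - g t (R *v y)\<bar> \<le> (LINT R|\<pi>. \<bar>g s (R *v y) - g t (R *v y)\<bar>)"
      by (rule integral_abs_bound)
    also have "\<dots> \<le> M\<^sub>g * (1 + (norm y)\<^sup>2) * \<bar>s - t\<bar>"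
    proof (rule \<pi>.integral_le_const)
      show "integrable \<pi> (\<lambda>R. \<bar>g s (R *v y) - g t (R *v y)\<bar>)"
        using int by simp
      show "AE R in \<pi>. \<bar>g s (R *v y) - g t (R *v y)\<bar> \<le> M\<^sub>g * (1 + (norm y)\<^sup>2) * \<bar>s - t\<bar>"
        using orth
      proof eventually_elim
        case (elim R)
        have "\<bar>g s (R *v y) - g t (R *v y)\<bar> \<le> M\<^sub>g * (1 + (norm (R *v y))\<^sup>2) * \<bar>s - t\<bar>"
          using bounded_derivative_family_diff[OF g_deriv(2)[OF I_pos] g_dsigma st] by simp
        then show ?case
          by (simp add: norm_orthogonal_matrix_mult(1)[OF elim])
      qed
    qed
    finally have "\<bar>avg_pot \<pi> g s y - avg_pot \<pi> g t y\<bar> \<le> M\<^sub>g * (1 + (norm y)\<^sup>2) * \<bar>s - t\<bar>"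
      using int by (simp add: avg_pot_def)
    then have "lam * \<bar>avg_pot \<pi> g s y - avg_pot \<pi> g t y\<bar> \<le> lam * (M\<^sub>g * (1 + (norm y)\<^sup>2) * \<bar>s - t\<bar>)"
      using lam_pos by (intro mult_left_mono) auto
    moreover have "\<bar>F s y - F t y\<bar> = lam * \<bar>avg_pot \<pi> g s y - avg_pot \<pi> g t y\<bar>"
      using lam_pos by (simp add: F_def objective_def flip: right_diff_distrib abs_mult_pos')
    ultimately show ?thesis
      by (simp add: mult_ac)
  qed

  \<comment> \<open>The stochastic gradient and its growth\<close>
  define G where "G k y R = gradient f y + lam *\<^sub>R (y - transpose R *v denoiser g (\<sigma> k) (R *v y))" for k y R
  \<comment> \<open>For orthogonal \<open>R\<close> the identity part of the denoiser is conjugated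
    to the identity and cancels \<open>y\<close>, leaving the integrand of the averaged
    gradient.\<close>
  have G_orth: "G k y R = gradient f y + lam *\<^sub>R (transpose R *v gradient (g (\<sigma> k)) (R *v y))"
    if "orthogonal_matrix R" for k y R
  proof -
    have "transpose R *v (R *v y) = y"
      using that by (simp add: orthogonal_matrix matrix_vector_mul_assoc del: transpose_matrix_vector)
    then show ?thesis
      by (simp add: G_def denoiser_def matrix_vector_mult_diff_distrib del: transpose_matrix_vector)
  qed
  have f_grad_cont: "continuous_on UNIV (gradient f)"
    using f_lip by (rule lipschitz_on_continuous_on)
  have g_grad_cont: "continuous_on UNIV (gradient (g (\<sigma> k)))" for k
    using g_lip[OF \<sigma>_I] by (rule lipschitz_on_continuous_on)
  have F_grad_cont: "continuous_on UNIV (gradient (F s))" if "s \<in> {\<epsilon>..\<sigma> 0}" for s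
    using F_lip[OF that] by (rule lipschitz_on_continuous_on)
  have G_cont: "continuous_on UNIV (\<lambda>(y, R). G k y R)" for k
    unfolding G_def denoiser_def split_beta
    by (intro continuous_intros continuous_on_matrix_vector_mult continuous_on_transpose
        continuous_on_compose2[OF f_grad_cont] continuous_on_compose2[OF g_grad_cont]) auto
  have V_cont: "continuous_on UNIV (V (\<sigma> k))" for k
    unfolding V_def using F_GDERIV[OF \<sigma>_I, unfolded gderiv_def]
    by (intro continuous_intros continuous_at_imp_continuous_on)
      (blast intro: has_derivative_continuous)

  \<comment> \<open>Compactness bounds the gradients at 0 uniformly in the parameter, so the growth
    constant \<open>B\<close> is independent of \<open>k\<close>.\<close>
  have "compact ((\<lambda>s. gradient (g s) 0) ` {\<epsilon>..\<sigma> 0})"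
  proof (rule compact_continuous_image)
    show "continuous_on {\<epsilon>..\<sigma> 0} (\<lambda>s. gradient (g s) 0)"
      using continuous_on_compose2[OF g_cont, of "{\<epsilon>..\<sigma> 0}" "\<lambda>s. (0, s)"]
      by (simp add: continuous_on_Pair image_subset_iff)
  qed simp
  then obtain K where K: "\<And>s. s \<in> {\<epsilon>..\<sigma> 0} \<Longrightarrow> norm (gradient (g s) 0) \<le> K"
    by (metis bounded_iff compact_imp_bounded imageI)
  have K0: "0 \<le> K"
    using K[OF \<epsilon>_I] norm_ge_zero order_trans by blast
  define B where "B = norm (gradient f 0) + L\<^sub>f + lam * (K + L\<^sub>g)"
  have G_norm: "norm (G k y R) \<le> B * (1 + norm y)" if "orthogonal_matrix R" for k y R
  proof -
    have "norm (G k y R) \<le> norm (gradient f y) + lam * norm (gradient (g (\<sigma> k)) (R *v y))"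
      using norm_triangle_ineq[of "gradient f y" "lam *\<^sub>R (transpose R *v gradient (g (\<sigma> k)) (R *v y))"] lam_pos
      by (simp add: G_orth[OF that] norm_orthogonal_matrix_mult[OF that] del: transpose_matrix_vector)
    also have "norm (gradient f y) \<le> norm (gradient f 0) + L\<^sub>f * norm y"
      by (rule A.norm_le_affine[OF f_GDERIV f_lip])
    also have "norm (gradient (g (\<sigma> k)) (R *v y)) \<le> K + L\<^sub>g * norm y"
      using A.norm_le_affine[OF g_GDERIV[OF \<sigma>_I] g_lip[OF \<sigma>_I], of k "R *v y"] K[OF \<sigma>_I, of k]
      by (simp add: norm_orthogonal_matrix_mult[OF that])
    finally have "norm (G k y R) \<le> norm (gradient f 0) + L\<^sub>f * norm y + lam * (K + L\<^sub>g * norm y)"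
      using lam_pos by simp
    also have "\<dots> \<le> B * (1 + norm y)"
    proof -
      have "0 \<le> norm (gradient f 0) * norm y" "0 \<le> lam * L\<^sub>g" "0 \<le> lam * K * norm y"
        using lam_pos Lg K0 by auto
      then show ?thesis
        using Lf by (simp add: B_def algebra_simps)
    qed
    finally show ?thesis .
  qed
  \<comment> \<open>From \<open>G_norm\<close>, the estimate of \<open>(1 + norm y)\<^sup>2\<close>
    by \<open>2 * (1 + (norm y)\<^sup>2)\<close>, and \<open>norm_le_V\<close>.\<close>
  define C where "C = 2 * B\<^sup>2 * C1"
  have C: "0 \<le> C"
    using C1 by (simp add: C_def)
  have G_bound: "(norm (G k y R))\<^sup>2 \<le> C * V (\<sigma> j) y" if "orthogonal_matrix R" for k j y R
  proof -
    have "(norm (G k y R))\<^sup>2 \<le> (B * (1 + norm y))\<^sup>2"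
      using G_norm[OF that] by (intro power_mono) auto
    also have "\<dots> = B\<^sup>2 * (1 + norm y)\<^sup>2"
      by (rule power_mult_distrib)
    also have "\<dots> \<le> B\<^sup>2 * (2 * (1 + (norm y)\<^sup>2))"
      using sum_squares_bound[of 1 "norm y"] by (intro mult_left_mono) (simp_all add: power2_sum)
    also have "\<dots> = 2 * B\<^sup>2 * (1 + (norm y)\<^sup>2)"
      by simp
    also have "\<dots> \<le> 2 * B\<^sup>2 * (C1 * V (\<sigma> j) y)"
      using norm_le_V[OF \<sigma>_I] by (intro mult_left_mono) auto
    finally show ?thesis by (simp add: C_def mult.assoc)
  qed

  \<comment> \<open>The iteration as an instance of the abstract scheme\<close>
  define a where "a k = lam * M\<^sub>g * C1 * (\<sigma> k - \<sigma> (Suc k))" for k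
  \<comment> \<open>The parameter differences telescope. Their factor combines \<open>F_diff\<close>
    with \<open>norm_le_V\<close>, which makes the drift relative to \<open>V\<close>.\<close>
  have a: "0 \<le> a k" "summable a" for k
    using sigma_dec[of k] lam_pos consts_pos C1 telescope_summable'[OF sigma_lim]
    by (auto simp: a_def[abs_def] intro!: summable_mult mult_nonneg_nonneg)

  interpret SG: stochastic_gradient M borel \<pi> Q G "\<lambda>k. gradient (F (\<sigma> k))" "\<lambda>k. V (\<sigma> k)" \<gamma> a C L x0 x
  proof
    show "sets \<pi> = sets borel" "M.indep_vars (\<lambda>_. borel) Q {1..}"
      by (fact pi_prob Q_indep)+
    show "distr M borel (Q k) = \<pi>" if "1 \<le> k" for k
      using Q_law that .
    show "(\<lambda>(y, R). G k y R) \<in> borel_measurable (borel \<Otimes>\<^sub>M borel)" for k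
      unfolding borel_prod using G_cont by (rule borel_measurable_continuous_onI)
    show "gradient (F (\<sigma> k)) \<in> borel_measurable borel" "V (\<sigma> k) \<in> borel_measurable borel" for k
      using F_grad_cont[OF \<sigma>_I] V_cont by (auto intro: borel_measurable_continuous_onI)
    show "x 0 \<omega> = x0" if "\<omega> \<in> space M" for \<omega>
      using x_0 that .
    show "x (Suc k) \<omega> = x k \<omega> - \<gamma> k *\<^sub>R G k (x k \<omega>) (Q (Suc k) \<omega>)" if "\<omega> \<in> space M" for k \<omega>
      using x_Suc[OF that] by (simp add: G_def)
    show "(LINT R|\<pi>. G k y R) = gradient (F (\<sigma> k)) y" for k y
    proof -
      \<comment> \<open>Measurability is needed separately, since \<open>G\<close> is known to agree
        with the simpler integrand only almost everywhere.\<close>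
      have meas: "(\<lambda>R. G k y R) \<in> borel_measurable \<pi>"
        using continuous_on_compose2[OF G_cont, of UNIV "\<lambda>R. (y, R)" k]
        by (simp add: borel_measurable_continuous_onI continuous_intros cong: measurable_cong_sets)
      have int: "integrable \<pi> (\<lambda>R. transpose R *v gradient (g (\<sigma> k)) (R *v y))"
        using avg(4) \<sigma>_I by blast
      have "(LINT R|\<pi>. G k y R) = (LINT R|\<pi>. gradient f y + lam *\<^sub>R (transpose R *v gradient (g (\<sigma> k)) (R *v y)))"
        using meas int orth G_orth by (intro integral_cong_AE) auto
      also have "\<dots> = gradient f y + lam *\<^sub>R gbar_grad (\<sigma> k) y"
        unfolding gbar_grad_def using int by (simp add: \<pi>.prob_space del: transpose_matrix_vector)
      finally show ?thesis
        by (simp add: F_grad[OF \<sigma>_I])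
    qed
    show "AE R in \<pi>. \<forall>k y. (norm (G k y R))\<^sup>2 \<le> C * V (\<sigma> k) y"
      using orth by eventually_elim (use G_bound in blast)
    show "1 \<le> V (\<sigma> k) y" for k y
      using V_ge_1[OF \<sigma>_I] .
    show "V (\<sigma> k) (y + d) \<le> V (\<sigma> k) y + gradient (F (\<sigma> k)) y \<bullet> d + L / 2 * (norm d)\<^sup>2" for k y d
    proof -
      have "GDERIV (F (\<sigma> k)) z :> gradient (F (\<sigma> k)) z" for z
        using F_GDERIV[OF \<sigma>_I] F_grad[OF \<sigma>_I] by simp
      from lipschitz_gradient_upper[OF this F_lip[OF \<sigma>_I], of y d] show ?thesis
        by (simp add: V_def)
    qed
    show "V (\<sigma> (Suc k)) y \<le> (1 + a k) * V (\<sigma> k) y" for k y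
    proof -
      have "F (\<sigma> (Suc k)) y - F (\<sigma> k) y \<le> lam * M\<^sub>g * (\<sigma> k - \<sigma> (Suc k)) * (1 + (norm y)\<^sup>2)"
        using F_diff[OF \<sigma>_I \<sigma>_I, of "Suc k" y k] sigma_dec[of k] by (simp add: abs_le_iff)
      also have "\<dots> \<le> lam * M\<^sub>g * (\<sigma> k - \<sigma> (Suc k)) * (C1 * V (\<sigma> k) y)"
        using norm_le_V[OF \<sigma>_I] lam_pos consts_pos sigma_dec[of k] by (intro mult_left_mono) auto
      finally show ?thesis
        by (simp add: V_def a_def algebra_simps)
    qed
    show "0 \<le> \<gamma> k" for k
      using gamma_bd(1)[of k] by simp
  qed (fact C L a gamma_sum(2))+

  \<comment> \<open>Consequences along a single trajectory\<close>
  have \<gamma>_lim: "\<gamma> \<longlonglongrightarrow> 0"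
    using summable_LIMSEQ_zero[OF gamma_sum(2)] by simp

  \<comment> \<open>From here the argument is deterministic: the assumed properties of
    \<open>\<omega>\<close> hold almost surely by the abstract scheme.\<close>
  have path: "bounded (range (\<lambda>k. x k \<omega>)) \<and> convergent (\<lambda>k. F \<epsilon> (x k \<omega>)) \<and>
      (\<lambda>k. norm (gradient (F \<epsilon>) (x k \<omega>))) \<longlonglongrightarrow> 0 \<and> (\<lambda>k. norm (x (Suc k) \<omega> - x k \<omega>)) \<longlonglongrightarrow> 0"
    if \<omega>: "\<omega> \<in> space M"
      and conv: "convergent (\<lambda>k. V (\<sigma> k) (x k \<omega>))"
      and summ: "summable (\<lambda>k. \<gamma> k * (norm (gradient (F (\<sigma> k)) (x k \<omega>)))\<^sup>2)"
      and Gb: "\<forall>k j y. (norm (G j y (Q (Suc k) \<omega>)))\<^sup>2 \<le> C * V (\<sigma> j) y" for \<omega>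
  proof -
    obtain W where W: "\<And>k. V (\<sigma> k) (x k \<omega>) \<le> W"
      using convergent_imp_Bseq[OF conv] unfolding Bseq_def real_norm_def abs_le_iff by blast
    have x_sq: "1 + (norm (x k \<omega>))\<^sup>2 \<le> C1 * W" for k
      using norm_le_V[OF \<sigma>_I, of "x k \<omega>" k] mult_left_mono[OF W, of C1 k] C1 by linarith
    \<comment> \<open>Orthogonal images of the iterates stay in the ball of radius \<open>r\<close>,
      where the gradients converge uniformly in the parameter.\<close>
    define r where "r = sqrt (C1 * W)"
    have x_r: "norm (x k \<omega>) \<le> r" for k
      unfolding r_def using x_sq[of k] by (intro real_le_rsqrt) simp
    then have bdd: "bounded (range (\<lambda>k. x k \<omega>))"
      by (auto simp: bounded_iff)

    have "(\<lambda>k. F \<epsilon> (x k \<omega>) - F (\<sigma> k) (x k \<omega>)) \<longlonglongrightarrow> 0"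
    proof (rule Lim_null_comparison)
      show "\<forall>\<^sub>F k in sequentially. norm (F \<epsilon> (x k \<omega>) - F (\<sigma> k) (x k \<omega>)) \<le> lam * M\<^sub>g * \<bar>\<epsilon> - \<sigma> k\<bar> * (C1 * W)"
      proof (rule always_eventually, rule allI)
        fix k
        have "norm (F \<epsilon> (x k \<omega>) - F (\<sigma> k) (x k \<omega>)) \<le> lam * M\<^sub>g * \<bar>\<epsilon> - \<sigma> k\<bar> * (1 + (norm (x k \<omega>))\<^sup>2)"
          using F_diff[OF \<epsilon>_I \<sigma>_I] by simp
        also have "\<dots> \<le> lam * M\<^sub>g * \<bar>\<epsilon> - \<sigma> k\<bar> * (C1 * W)"
          using x_sq[of k] lam_pos consts_pos by (intro mult_left_mono) auto
        finally show "norm (F \<epsilon> (x k \<omega>) - F (\<sigma> k) (x k \<omega>)) \<le> lam * M\<^sub>g * \<bar>\<epsilon> - \<sigma> k\<bar> * (C1 * W)" .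
      qed
      show "(\<lambda>k. lam * M\<^sub>g * \<bar>\<epsilon> - \<sigma> k\<bar> * (C1 * W)) \<longlonglongrightarrow> 0"
        using sigma_lim by (auto intro!: tendsto_eq_intros)
    qed
    \<comment> \<open>The constant undoes the shift in \<open>V\<close>, so that the sum is
      \<open>F \<epsilon> (x k \<omega>)\<close>.\<close>
    then have "convergent (\<lambda>k. (F \<epsilon> (x k \<omega>) - F (\<sigma> k) (x k \<omega>)) + (V (\<sigma> k) (x k \<omega>) + (mf - lam * C\<^sub>0 - 1)))"
      using conv by (intro convergent_add convergent_const) (auto simp: convergent_def)
    then have F_conv: "convergent (\<lambda>k. F \<epsilon> (x k \<omega>))"
      by (simp add: V_def)

    define D where "D = sqrt (C * W)"
    have step: "norm (x (Suc k) \<omega> - x k \<omega>) \<le> D * \<gamma> k" for k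
    proof -
      have "(norm (G k (x k \<omega>) (Q (Suc k) \<omega>)))\<^sup>2 \<le> C * W"
        using Gb W[of k] C by (meson mult_left_mono order_trans)
      then have "norm (G k (x k \<omega>) (Q (Suc k) \<omega>)) \<le> D"
        unfolding D_def by (rule real_le_rsqrt)
      then show ?thesis
        using SG.x_Suc[OF \<omega>, of k] gamma_bd(1)[of k] by simp
    qed
    have step_lim: "(\<lambda>k. norm (x (Suc k) \<omega> - x k \<omega>)) \<longlonglongrightarrow> 0"
    proof (rule Lim_null_comparison)
      show "\<forall>\<^sub>F k in sequentially. norm (norm (x (Suc k) \<omega> - x k \<omega>)) \<le> D * \<gamma> k"
        using step by simp
      show "(\<lambda>k. D * \<gamma> k) \<longlonglongrightarrow> 0"
        using \<gamma>_lim by (rule tendsto_mult_right_zero)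
    qed

    let ?h = "\<lambda>k. norm (gradient (F \<epsilon>) (x k \<omega>))" and ?r = "\<lambda>k. norm (gradient (F (\<sigma> k)) (x k \<omega>))"
    have "(\<lambda>k. ?h k - ?r k) \<longlonglongrightarrow> 0"
    proof (rule tendstoI)
      fix e :: real assume e: "0 < e"
      \<comment> \<open>Integration yields a non-strict bound by \<open>e'\<close>; the factor 2
        makes \<open>lam * e'\<close> strictly smaller than \<open>e\<close>.\<close>
      define e' where "e' = e / (2 * lam)"
      have e': "0 < e'"
        using e lam_pos by (simp add: e'_def)
      have "\<forall>\<^sub>F k in sequentially. \<forall>y\<in>cball 0 r. dist (gradient (g (\<sigma> k)) y) (gradient (g \<epsilon>) y) < e'"
        by (rule uniform_parameter_limit[OF g_cont \<sigma>_I sigma_lim \<epsilon>_I e'])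
      then show "\<forall>\<^sub>F k in sequentially. dist (?h k - ?r k) 0 < e"
      proof eventually_elim
        case (elim k)
        let ?y = "x k \<omega>"
        let ?q = "\<lambda>s R. transpose R *v gradient (g s) (R *v ?y)"
        have int: "integrable \<pi> (?q \<epsilon>)" "integrable \<pi> (?q (\<sigma> k))"
          using avg(4) \<epsilon>_I \<sigma>_I by blast+
        have "norm (gbar_grad \<epsilon> ?y - gbar_grad (\<sigma> k) ?y) = norm (LINT R|\<pi>. ?q \<epsilon> R - ?q (\<sigma> k) R)"
          unfolding gbar_grad_def using int by (simp del: transpose_matrix_vector)
        also have "\<dots> \<le> (LINT R|\<pi>. norm (?q \<epsilon> R - ?q (\<sigma> k) R))"
          by (rule integral_norm_bound)
        also have "\<dots> \<le> e'"
        proof (rule \<pi>.integral_le_const)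
          show "integrable \<pi> (\<lambda>R. norm (?q \<epsilon> R - ?q (\<sigma> k) R))"
            using int by (simp del: transpose_matrix_vector)
          show "AE R in \<pi>. norm (?q \<epsilon> R - ?q (\<sigma> k) R) \<le> e'"
            using orth
          proof eventually_elim
            case (elim R)
            then have "R *v ?y \<in> cball 0 r"
              using x_r[of k] by (simp add: norm_orthogonal_matrix_mult)
            then have "dist (gradient (g (\<sigma> k)) (R *v ?y)) (gradient (g \<epsilon>) (R *v ?y)) < e'"
              using \<open>\<forall>y\<in>cball 0 r. _\<close> by blast
            then show ?case
              using elim
              by (simp add: norm_orthogonal_matrix_mult dist_norm norm_minus_commute
                  del: transpose_matrix_vector flip: matrix_vector_mult_diff_distrib)
          qed
        qed
        finally have "norm (gbar_grad \<epsilon> ?y - gbar_grad (\<sigma> k) ?y) \<le> e'" .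
        then have "norm (gradient (F \<epsilon>) ?y - gradient (F (\<sigma> k)) ?y) \<le> lam * e'"
          using lam_pos
          by (simp add: F_grad[OF \<epsilon>_I] F_grad[OF \<sigma>_I] flip: scaleR_diff_right)
        also have "lam * e' < e"
          using e lam_pos by (simp add: e'_def)
        finally show ?case
          using norm_triangle_ineq3[of "gradient (F \<epsilon>) ?y" "gradient (F (\<sigma> k)) ?y"]
          by (simp add: dist_real_def)
      qed
    qed
    \<comment> \<open>The added 1 keeps the constant positive even if \<open>L * D\<close>
      vanishes.\<close>
    moreover have "?h (Suc k) \<le> ?h k + (L * D + 1) * \<gamma> k" for k
    proof -
      have "?h (Suc k) \<le> ?h k + norm (gradient (F \<epsilon>) (x (Suc k) \<omega>) - gradient (F \<epsilon>) (x k \<omega>))"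
        by (simp add: norm_triangle_sub)
      also have "norm (gradient (F \<epsilon>) (x (Suc k) \<omega>) - gradient (F \<epsilon>) (x k \<omega>)) \<le> L * norm (x (Suc k) \<omega> - x k \<omega>)"
        using lipschitz_onD[OF F_lip[OF \<epsilon>_I], of "x (Suc k) \<omega>" "x k \<omega>"] by (simp add: dist_norm)
      also have "\<dots> \<le> L * (D * \<gamma> k)"
        using step L by (intro mult_left_mono)
      finally show ?thesis
        using gamma_bd(1)[of k] by (simp add: algebra_simps)
    qed
    moreover have "0 < L * D + 1"
    proof -
      have "0 \<le> D"
        using step[of 0] gamma_bd(1)[of 0] norm_ge_zero[of "x (Suc 0) \<omega> - x 0 \<omega>"]
        by (meson order_trans zero_le_mult_iff not_le)
      then show ?thesis
        using L by (simp add: add_nonneg_pos)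
    qed
    ultimately have "?h \<longlonglongrightarrow> 0"
      using gamma_bd(1) gamma_sum(1) \<gamma>_lim summ
      by (intro slowly_varying_tendsto_0[of \<gamma> ?r ?h "L * D + 1"]) (auto intro: less_imp_le)
    with bdd F_conv step_lim show ?thesis by blast
  qed

  \<comment> \<open>Almost sure conclusions and existence of critical points\<close>
  have ae: "AE \<omega> in M. bounded (range (\<lambda>k. x k \<omega>)) \<and> convergent (\<lambda>k. F \<epsilon> (x k \<omega>)) \<and>
      summable (\<lambda>k. \<gamma> k * (norm (gradient (F (\<sigma> k)) (x k \<omega>)))\<^sup>2) \<and>
      (\<lambda>k. norm (gradient (F \<epsilon>) (x k \<omega>))) \<longlonglongrightarrow> 0 \<and> crit (F \<epsilon>) \<noteq> {} \<and>
      (\<lambda>k. infdist (x k \<omega>) (crit (F \<epsilon>))) \<longlonglongrightarrow> 0 \<and> (\<lambda>k. norm (x (Suc k) \<omega> - x k \<omega>)) \<longlonglongrightarrow> 0"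
    using SG.pathwise_convergence SG.G_path_bound AE_space
  proof eventually_elim
    case (elim \<omega>)
    then have p: "bounded (range (\<lambda>k. x k \<omega>))" "convergent (\<lambda>k. F \<epsilon> (x k \<omega>))"
      "(\<lambda>k. norm (gradient (F \<epsilon>) (x k \<omega>))) \<longlonglongrightarrow> 0" "(\<lambda>k. norm (x (Suc k) \<omega> - x k \<omega>)) \<longlonglongrightarrow> 0"
      using path[of \<omega>] by blast+
    from infdist_zero_set_tendsto_0[OF p(1) F_grad_cont[OF \<epsilon>_I] tendsto_norm_zero_cancel[OF p(3)]]
    show ?case
      using p elim(1) unfolding crit_def by blast
  qed
  \<comment> \<open>The statement does not involve \<open>\<omega>\<close>, so holding almost surely
    in a probability space it holds outright.\<close>
  have "AE \<omega> in M. crit (F \<epsilon>) \<noteq> {}"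
    using ae by eventually_elim blast
  then have crit: "crit (F \<epsilon>) \<noteq> {}"
    by simp

  \<comment> \<open>The rate in expectation\<close>
  define E where "E k = (LINT \<omega>|M. (norm (gradient (F (\<sigma> k)) (x k \<omega>)))\<^sup>2)" for k
  have E0: "0 \<le> E k" for k
    by (simp add: E_def)
  have "(\<lambda>K. MIN k\<in>{0..K}. E k) \<in> O(\<lambda>K. inverse (\<Sum>k=0..K. \<gamma> k))"
  proof (rule bigoI[of _ "\<Sum>k. \<gamma> k * E k"], rule always_eventually, rule allI)
    fix K
    have "(\<Sum>k=0..K. \<gamma> k * E k) \<le> (\<Sum>k. \<gamma> k * E k)"
      using SG.summable_expectation[folded E_def] gamma_bd(1) E0
      by (intro sum_le_suminf) (auto intro: mult_nonneg_nonneg less_imp_le)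
    then have "(MIN k\<in>{0..K}. E k) \<le> (\<Sum>k. \<gamma> k * E k) * inverse (\<Sum>k=0..K. \<gamma> k)"
      using gamma_bd(1) by (intro Min_le_weighted_average)
    moreover have "0 \<le> (MIN k\<in>{0..K}. E k)"
      using E0 by simp
    moreover have "0 \<le> (\<Sum>k=0..K. \<gamma> k)"
      using gamma_bd(1) by (intro sum_nonneg) (auto intro: less_imp_le)
    ultimately show "norm (MIN k\<in>{0..K}. E k) \<le> (\<Sum>k. \<gamma> k * E k) * norm (inverse (\<Sum>k=0..K. \<gamma> k))"
      by simp
  qed
  then show ?thesis
    using crit ae SG.integrable_norm_h_sq unfolding E_def
    by (auto elim: eventually_mono)
qed

end
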